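(* Let $A\in\mathrm{M}_n(\mathbb{C})$. For $d\ge 2$ even, $\binom{d}{d/2} |\!|\!| A |\!|\!|_d^d$ is the coefficient of $z^{d/2}\overline{z}^{d/2}$ in the Taylor expansion (in $z$ and $\overline{z}$) of $\det(I-zA-\overline{z}A^* )^{-1}$ about the origin.
   Context: $\mathrm{M}_n(\mathbb{C})$ is the space of $n\times n$ complex matrices and $A^*$ is the conjugate transpose of $A$. For even $d\ge2$, the norm $|\!|\!|\cdot|\!|\!|_d$ on $\mathrm{M}_n(\mathbb{C})$ is defined by $$|\!|\!| A |\!|\!|_{d}= \bigg( \sum_{\boldsymbol{\pi} \,\vdash\, d} \frac{\mathrm{T}_{\boldsymbol{\pi}}(A)}{z_{\boldsymbol{\pi}}}\bigg)^{1/d},$$ where the sum runs over all partitions $\boldsymbol{\pi}=(\pi_1,\ldots,\pi_r)$ of $d$ ($\pi_1\ge\cdots\ge\pi_r\ge1$, $\sum_j\pi_j=d$); $z_{\boldsymbol{\pi}}=\prod_{i\ge1} i^{m_i}m_i!$ with $m_i$ the multiplicity of $i$ in $\boldsymbol{\pi}$; and $\mathrm{T}_{\boldsymbol{\pi}}(A)$ is $1/\binom{d}{d/2}$ times the sum, over the $\binom{d}{d/2}$ ways to choose $d/2$ of the $d$ copies of $A$ in $(\operatorname{tr}A^{\pi_1})(\operatorname{tr}A^{\pi_2})\cdots(\operatorname{tr}A^{\pi_r})$ (each power written out as a product of copies of $A$) and replace them by $A^*$, of the resulting expressions. *)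

theory Defs
  imports
    "Jordan_Normal_Form.Schur_Decomposition"
    "HOL-Analysis.Infinite_Sum"
begin

definition mat_trace :: "'a :: comm_monoid_add mat \<Rightarrow> 'a" where
  "mat_trace A = (\<Sum>i<dim_row A. A $$ (i, i))"

text \<open>A partition of \<open>d\<close> is the non-increasing list of its positive parts.\<close>

definition partitions_of :: "nat \<Rightarrow> nat list set" where
  "partitions_of d = {p. sorted_wrt (\<ge>) p \<and> (\<forall>k\<in>set p. k \<ge> 1) \<and> sum_list p = d}"

lemma finite_partitions_of: "finite (partitions_of d)"
proof (rule finite_subset)
  have "length p \<le> sum_list p" if "\<forall>k\<in>set p. k \<ge> 1" for p :: "nat list"
    using that by (induction p) auto
  then show "partitions_of d \<subseteq> {p. set p \<subseteq> {..d} \<and> length p \<le> d}"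
    by (auto simp: partitions_of_def intro: member_le_sum_list)
  show "finite {p. set p \<subseteq> {..d} \<and> length p \<le> d}"
    by (rule finite_lists_length_le) simp
qed

text \<open>Sizes that are not parts have multiplicity 0 and contribute the factor 1.\<close>

definition z_partition :: "nat list \<Rightarrow> nat" where
  "z_partition p = (\<Prod>i\<in>set p. i ^ count_list p i * fact (count_list p i))"

fun split_blocks :: "nat list \<Rightarrow> 'a list \<Rightarrow> 'a list list" where
  "split_blocks [] xs = []"
| "split_blocks (k # ks) xs = take k xs # split_blocks ks (drop k xs)"

text \<open>The expression \<open>tr A\<^sup>p\<^sup>1 \<cdots> tr A\<^sup>p\<^sup>r\<close> contains \<open>sum_list p\<close> copies of \<open>A\<close>, numbered
  \<open>0, 1, \<dots>\<close> from left to right; the copies at the positions in \<open>S\<close> are replaced by the adjoint.\<close>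

definition replaced_trace_prod :: "nat list \<Rightarrow> nat set \<Rightarrow> complex mat \<Rightarrow> complex" where
  "replaced_trace_prod p S A =
     (let copies = map (\<lambda>j. if j \<in> S then mat_adjoint A else A) [0..<sum_list p]
      in prod_list (map (\<lambda>Bs. mat_trace (foldr (*) Bs (1\<^sub>m (dim_row A)))) (split_blocks p copies)))"

definition T_partition :: "nat list \<Rightarrow> complex mat \<Rightarrow> complex" where
  "T_partition p A =
     (let d = sum_list p
      in (\<Sum>S | S \<subseteq> {..<d} \<and> card S = d div 2. replaced_trace_prod p S A)
           / of_nat (d choose (d div 2)))"

text \<open>For even \<open>d \<ge> 2\<close> the complex sum is a nonnegative real number, so \<^const>\<open>Re\<close> only changes
  the type, and \<^const>\<open>root\<close> is the ordinary nonnegative \<open>d\<close>-th root.\<close>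

definition partition_norm :: "nat \<Rightarrow> complex mat \<Rightarrow> real" where
  "partition_norm d A =
     root d (Re (\<Sum>p\<in>partitions_of d. T_partition p A / of_nat (z_partition p)))"

text \<open>\<open>c j k\<close> is the coefficient of \<open>z\<^sup>j (cnj z)\<^sup>k\<close> in a double power series that converges
  unconditionally to \<open>f z\<close> for all \<open>z\<close> in a neighbourhood of the origin.\<close>

definition has_zzbar_expansion_at_0 ::
    "(complex \<Rightarrow> complex) \<Rightarrow> (nat \<Rightarrow> nat \<Rightarrow> complex) \<Rightarrow> bool" where
  "has_zzbar_expansion_at_0 f c \<longleftrightarrow>
     (\<exists>r>0. \<forall>z. norm z < r \<longrightarrow> ((\<lambda>(j, k). c j k * z ^ j * cnj z ^ k) has_sum f z) UNIV)"

end

theory Submission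
  imports
    Defs
    "HOL-Computational_Algebra.Polynomial_FPS"
    "HOL-Analysis.Elementary_Metric_Spaces"
begin

text \<open>Let \<open>H = z A + cnj z A\<^sup>*\<close>, with eigenvalues \<open>e\<^sub>1, \<dots>, e\<^sub>n\<close>. Formally
  \<open>det (I - H)\<^sup>-\<^sup>1 = \<Prod>\<^sub>i (1 - e\<^sub>i)\<^sup>-\<^sup>1 = \<Sum>\<^sub>d h\<^sub>d(e)\<close> with \<open>h\<^sub>d\<close> the complete homogeneous symmetric
  polynomial, and \<open>h\<^sub>d = \<Sum>\<^sub>\<pi> p\<^sub>\<pi> / z\<^sub>\<pi>\<close>, summed over the partitions \<open>\<pi>\<close> of \<open>d\<close>, in terms of power
  sums (lemma \<open>cycle_index_power_sum\<close>: both sides satisfy Newton's recursion). The power sums of the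
  eigenvalues are the traces of the powers of \<open>H\<close> (\<open>mat_trace_power\<close>). Multiplying out these traces,
  the terms in which \<open>j\<close> of the \<open>d\<close> factors are \<open>A\<^sup>*\<close> carry \<open>z\<^sup>d\<^sup>-\<^sup>j (cnj z)\<^sup>j\<close>, so \<open>h\<^sub>d(e)\<close> is a
  homogeneous polynomial in \<open>z\<close> and \<open>cnj z\<close> with explicit coefficients \<open>trace_coeff A d j\<close>
  (\<open>trace_coeff_generating\<close>). For \<open>j = d/2\<close> the coefficient is the binomial coefficient times the
  sum in the definition of the norm (\<open>trace_coeff_middle\<close>).

  Three things remain. Convergence: the coefficients of degree \<open>d\<close> are at most \<open>K\<^sup>d\<close> in total
  (\<open>trace_coeff_bound\<close>), so near the origin the double series converges absolutely and can be summed by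
  degree (\<open>has_zzbar_expansion_inverse_det\<close>). Uniqueness of the expansion: restrict to lines through
  the origin (\<open>has_zzbar_expansion_unique\<close>).

  Finally, the sum under the \<open>d\<close>-th root has to be real and nonnegative. The matrix \<open>H\<close> is Hermitian,
  so \<open>h\<^sub>d(e)\<close> is evaluated at real numbers and is nonnegative for even \<open>d\<close> by Hunter's theorem
  (\<open>complete_homogeneous_nonneg\<close>); the coefficient in question is an average of such values over
  roots of unity \<open>z\<close> (\<open>trace_coeff_middle_nonneg\<close>). Hunter's theorem is proved through the operators
  \<open>(1 - x D)\<^sup>-\<^sup>1\<close>, with \<open>D\<close> the derivative of real polynomials: they preserve nonnegativity, and applying
  one for each variable \<open>x\<close> to \<open>t\<^sup>d / d!\<close> gives a polynomial with constant term \<open>h\<^sub>d\<close>.\<close>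

section \<open>Complete homogeneous symmetric polynomials and their Newton identity\<close>

text \<open>The recursion separates the monomials of degree \<open>d\<close> that do not contain the first variable from
  those that do.\<close>

fun complete_homogeneous :: "'a::comm_ring_1 list \<Rightarrow> nat \<Rightarrow> 'a" where
  "complete_homogeneous [] d = (if d = 0 then 1 else 0)"
| "complete_homogeneous (x # xs) 0 = 1"
| "complete_homogeneous (x # xs) (Suc d) =
     complete_homogeneous xs (Suc d) + x * complete_homogeneous (x # xs) d"

lemma complete_homogeneous_0 [simp]: "complete_homogeneous xs 0 = 1"
  by (cases xs) auto

lemma complete_homogeneous_of_real:
  "complete_homogeneous (map of_real xs) d = (of_real (complete_homogeneous xs d) :: complex)"
  by (induction xs d rule: complete_homogeneous.induct) auto

definition power_sum :: "'a::comm_ring_1 list \<Rightarrow> nat \<Rightarrow> 'a" where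
  "power_sum xs k = sum_list (map (\<lambda>x. x ^ k) xs)"

lemma fps_nth_mult_linear:
  fixes F :: "'a::comm_ring_1 fps"
  shows "fps_nth (F * (1 - fps_const x * fps_X)) d
     = fps_nth F d - (if d = 0 then 0 else x * fps_nth F (d - 1))"
proof -
  have "F * (1 - fps_const x * fps_X) = F - fps_const x * (fps_X * F)"
    by (simp add: algebra_simps)
  then show ?thesis by simp
qed

text \<open>The defining recursion, read as an identity of generating functions.\<close>
lemma complete_homogeneous_Cons_fps:
  "Abs_fps (complete_homogeneous (x # xs)) * (1 - fps_const x * fps_X)
     = Abs_fps (complete_homogeneous xs)"
proof (rule fps_ext)
  fix d
  show "fps_nth (Abs_fps (complete_homogeneous (x # xs)) * (1 - fps_const x * fps_X)) d
      = fps_nth (Abs_fps (complete_homogeneous xs)) d"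
    unfolding fps_nth_mult_linear by (cases d) simp_all
qed

lemma complete_homogeneous_fps:
  "Abs_fps (complete_homogeneous xs) * prod_list (map (\<lambda>x. 1 - fps_const x * fps_X) xs) = 1"
proof (induction xs)
  case Nil
  show ?case by (auto intro: fps_ext)
next
  case (Cons x xs)
  then show ?case
    by (simp add: complete_homogeneous_Cons_fps mult.assoc[symmetric] del: complete_homogeneous.simps)
qed

lemma power_sum_Cons_fps:
  "Abs_fps (\<lambda>k. power_sum (x # xs) (Suc k)) * (1 - fps_const x * fps_X)
     = fps_const x + Abs_fps (\<lambda>k. power_sum xs (Suc k)) * (1 - fps_const x * fps_X)"
proof (rule fps_ext)
  fix d
  show "fps_nth (Abs_fps (\<lambda>k. power_sum (x # xs) (Suc k)) * (1 - fps_const x * fps_X)) d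
     = fps_nth (fps_const x + Abs_fps (\<lambda>k. power_sum xs (Suc k)) * (1 - fps_const x * fps_X)) d"
    unfolding fps_nth_mult_linear fps_add_nth
    by (cases d) (simp_all add: power_sum_def algebra_simps)
qed

text \<open>With \<open>F\<close> the generating function of the complete homogeneous polynomials and \<open>P\<close> that of the
  shifted power sums, this is the logarithmic derivative \<open>F' / F = P\<close> of
  \<open>F = \<Prod>\<^sub>x 1 / (1 - x X)\<close>. A new variable multiplies \<open>F\<close> by \<open>1 / u\<close> with
  \<open>u = 1 - x X\<close>, hence adds \<open>x / u\<close> to \<open>F' / F\<close>; multiplying by \<open>u\<close> avoids the division.\<close>
lemma deriv_complete_homogeneous_fps:
  fixes xs :: "'a::idom list"
  shows "fps_deriv (Abs_fps (complete_homogeneous xs))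
     = Abs_fps (complete_homogeneous xs) * Abs_fps (\<lambda>k. power_sum xs (Suc k))"
proof (induction xs)
  case Nil
  show ?case by (auto intro!: fps_ext simp: power_sum_def fps_mult_nth)
next
  case (Cons x xs)
  define F where "F = Abs_fps (complete_homogeneous (x # xs))"
  define u :: "'a fps" where "u = 1 - fps_const x * fps_X"
  define P where "P = Abs_fps (\<lambda>k. power_sum xs (Suc k))"
  define Q where "Q = Abs_fps (\<lambda>k. power_sum (x # xs) (Suc k))"
  have Fu: "Abs_fps (complete_homogeneous xs) = F * u"
    unfolding F_def u_def by (rule complete_homogeneous_Cons_fps[symmetric])
  have u': "fps_deriv u = - fps_const x"
    by (simp add: u_def)
  have Qu: "Q * u = fps_const x + P * u"
    unfolding Q_def u_def P_def by (rule power_sum_Cons_fps)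
  have "fps_deriv (F * u) = F * u * P"
    using Cons.IH unfolding Fu P_def .
  then have "fps_deriv F * u = F * (fps_const x + P * u)"
    by (simp add: u' algebra_simps del: fps_const_neg)
  also have "\<dots> = F * Q * u"
    by (simp add: Qu[symmetric] mult.assoc)
  finally have "fps_deriv F * u = F * Q * u" .
  moreover have "u \<noteq> 0"
  proof
    assume "u = 0"
    then have "fps_nth u 0 = 0" by simp
    then show False by (simp add: u_def)
  qed
  ultimately show ?case by (simp add: F_def Q_def)
qed

lemma newton_complete_homogeneous:
  fixes xs :: "'a::idom list"
  shows "of_nat d * complete_homogeneous xs d
     = (\<Sum>k = 1..d. power_sum xs k * complete_homogeneous xs (d - k))"
proof (cases d)
  case (Suc m)
  have "of_nat d * complete_homogeneous xs d
      = fps_nth (fps_deriv (Abs_fps (complete_homogeneous xs))) m"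
    by (simp add: Suc)
  also have "\<dots> = (\<Sum>k = 0..m. power_sum xs (Suc k) * complete_homogeneous xs (m - k))"
    by (subst deriv_complete_homogeneous_fps, subst mult.commute) (simp add: fps_mult_nth)
  also have "\<dots> = (\<Sum>k = 1..d. power_sum xs k * complete_homogeneous xs (d - k))"
    using sum.shift_bounds_cl_Suc_ivl
      [of "\<lambda>k. power_sum xs k * complete_homogeneous xs (d - k)" 0 m]
    by (simp add: Suc del: sum.cl_ivl_Suc)
  finally show ?thesis .
qed auto

section \<open>The cycle index as a sum over partitions\<close>

text \<open>With \<open>X k = t\<^sub>k\<close> this is the cycle index of the symmetric group on \<open>d\<close> points: a fraction
  \<open>1 / z_partition p\<close> of all permutations has cycle type \<open>p\<close>.\<close>

definition cycle_index :: "nat \<Rightarrow> (nat \<Rightarrow> 'a::field_char_0) \<Rightarrow> 'a" where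
  "cycle_index d X = (\<Sum>p\<in>partitions_of d. prod_list (map X p) / of_nat (z_partition p))"

lemma z_partition_superset:
  assumes "finite D" "set p \<subseteq> D"
  shows "z_partition p = (\<Prod>i\<in>D. i ^ count_list p i * fact (count_list p i))"
  unfolding z_partition_def using assms
  by (intro prod.mono_neutral_left) auto

lemma count_list_remove1:
  "count_list (remove1 k p) i = (if i = k then count_list p i - 1 else count_list p i)"
  by (simp flip: count_mset)

lemma z_partition_remove1:
  assumes "k \<in> set p"
  shows "z_partition p = k * count_list p k * z_partition (remove1 k p)"
proof -
  define w where "w q i = i ^ count_list q i * fact (count_list q i)" for q and i :: nat
  define m where "m = count_list p k - 1"
  have m: "count_list p k = Suc m"
    using assms by (simp add: m_def count_list_0_iff Suc_diff_1 neq0_conv[symmetric] del: neq0_conv)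
  have "z_partition p = w p k * (\<Prod>i\<in>set p - {k}. w p i)"
    using assms by (simp add: z_partition_def w_def prod.remove)
  also have "w p k = k * count_list p k * w (remove1 k p) k"
    by (simp add: w_def count_list_remove1 m algebra_simps)
  also have "(\<Prod>i\<in>set p - {k}. w p i) = (\<Prod>i\<in>set p - {k}. w (remove1 k p) i)"
    by (intro prod.cong) (auto simp: w_def count_list_remove1)
  also have "k * count_list p k * w (remove1 k p) k * \<dots>
      = k * count_list p k * (\<Prod>i\<in>set p. w (remove1 k p) i)"
    using assms by (simp add: prod.remove mult.assoc)
  also have "(\<Prod>i\<in>set p. w (remove1 k p) i) = z_partition (remove1 k p)"
    unfolding w_def by (rule z_partition_superset[symmetric]) (auto simp: set_remove1_subset)
  finally show ?thesis .
qed

lemma z_partition_pos: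
  assumes "p \<in> partitions_of d"
  shows "z_partition p > 0"
  using assms unfolding z_partition_def partitions_of_def
  by (intro prod_pos) auto

lemma decreasing_eq_if_mset_eq:
  fixes p q :: "nat list"
  assumes "sorted_wrt (\<ge>) p" "sorted_wrt (\<ge>) q" "mset p = mset q"
  shows "p = q"
proof -
  have "sort (rev p) = rev p" "sort (rev q) = rev q"
    using assms(1,2) by (auto simp: sorted_sort_id sorted_wrt_rev)
  moreover have "sort (rev p) = sort (rev q)"
    by (rule properties_for_sort) (simp_all add: assms(3))
  ultimately show ?thesis by (metis rev_rev_ident)
qed

lemma sum_list_remove1_nat:
  "k \<in> set p \<Longrightarrow> sum_list (remove1 k p) = sum_list p - (k::nat)"
  by (induction p) (auto simp: member_le_sum_list)

text \<open>Removing one copy of a part \<open>k\<close> from a partition of \<open>d\<close> is undone by inserting \<open>k\<close> at its place in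
  the decreasing order.\<close>
lemma sum_over_parts:
  fixes g :: "nat \<Rightarrow> nat list \<Rightarrow> 'a::comm_monoid_add"
  shows "(\<Sum>p\<in>partitions_of d. \<Sum>k\<in>set p. g k (remove1 k p))
     = (\<Sum>k = 1..d. \<Sum>q\<in>partitions_of (d - k). g k q)"
proof -
  define ins where "ins k q = rev (insort k (rev q))" for k :: nat and q
  have mset_ins: "mset (ins k q) = add_mset k (mset q)" for k q
    by (simp add: ins_def)
  have set_ins: "set (ins k q) = insert k (set q)" for k q
    by (simp add: ins_def set_insort_key)
  have desc_ins: "sorted_wrt (\<ge>) (ins k q)" if "sorted_wrt (\<ge>) q" for k q
  proof -
    have "sorted (insort k (rev q))"
      using that by (simp add: sorted_insort sorted_wrt_rev)
    then show ?thesis by (simp add: ins_def sorted_wrt_rev)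
  qed
  have desc_rem: "sorted_wrt (\<ge>) (remove1 k p)" if "sorted_wrt (\<ge>) p" for k :: nat and p
    using that by (induction p) (auto dest: subsetD[OF set_remove1_subset])
  have ins_remove1: "ins k (remove1 k p) = p" if "sorted_wrt (\<ge>) p" "k \<in> set p" for k p
    using that by (intro decreasing_eq_if_mset_eq desc_ins desc_rem) (simp_all add: mset_ins)
  have remove1_ins: "remove1 k (ins k q) = q" if "sorted_wrt (\<ge>) q" for k q
    using that by (intro decreasing_eq_if_mset_eq desc_ins desc_rem) (simp_all add: mset_ins)
  have sum_ins: "sum_list (ins k q) = k + sum_list q" for k q
    by (simp add: mset_ins flip: sum_mset_sum_list)
  have "(\<Sum>p\<in>partitions_of d. \<Sum>k\<in>set p. g k (remove1 k p))
      = (\<Sum>(p, k)\<in>(SIGMA p:partitions_of d. set p). g k (remove1 k p))"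
    by (rule sum.Sigma) (auto simp: finite_partitions_of)
  also have "\<dots> = (\<Sum>(k, q)\<in>(SIGMA k:{1..d}. partitions_of (d - k)). g k q)"
  proof (rule sum.reindex_bij_witness[of _ "\<lambda>(k, q). (ins k q, k)" "\<lambda>(p, k). (k, remove1 k p)"], goal_cases)
    case (1 a)
    then show ?case by (auto simp: partitions_of_def ins_remove1)
  next
    case (2 a)
    then show ?case
      by (auto simp: partitions_of_def sum_list_remove1_nat desc_rem member_le_sum_list
          dest: subsetD[OF set_remove1_subset])
  next
    case (3 b)
    then show ?case by (auto simp: partitions_of_def remove1_ins)
  next
    case (4 b)
    then show ?case
      by (auto simp: partitions_of_def desc_ins set_ins sum_ins)
  next
    case (5 a)
    then show ?case by auto
  qed
  also have "\<dots> = (\<Sum>k = 1..d. \<Sum>q\<in>partitions_of (d - k). g k q)"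
    by (rule sum.Sigma[symmetric]) (auto simp: finite_partitions_of)
  finally show ?thesis .
qed

lemma sum_list_eq_sum_count_nat:
  "sum_list p = (\<Sum>k\<in>set p. k * count_list p (k::nat))"
  using sum_list_map_eq_sum_count[of "\<lambda>x. x" p] by (simp add: mult.commute)

lemma prod_list_map_remove1:
  fixes X :: "'b \<Rightarrow> 'a::comm_monoid_mult"
  assumes "k \<in> set p"
  shows "prod_list (map X p) = X k * prod_list (map X (remove1 k p))"
  using assms by (induction p) (auto simp: mult.left_commute)

text \<open>Write the factor \<open>d\<close> of the term of \<open>p\<close> as \<open>\<Sum>\<^sub>k k m\<^sub>k\<close> with \<open>m\<^sub>k\<close> the multiplicity of the part
  \<open>k\<close>. Since \<open>z_partition p\<close> is \<open>k m\<^sub>k\<close> times the same quantity for \<open>p\<close> with one part \<open>k\<close> removed,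
  the factor \<open>k m\<^sub>k\<close> cancels.\<close>
lemma newton_cycle_index:
  "of_nat d * cycle_index d X = (\<Sum>k = 1..d. X k * cycle_index (d - k) X)"
proof -
  let ?w = "\<lambda>p. prod_list (map X p) / of_nat (z_partition p)"
  have step: "of_nat (k * count_list p k) * ?w p = X k * ?w (remove1 k p)"
    if p: "p \<in> partitions_of d" and k: "k \<in> set p" for p k
  proof -
    define c :: 'a where "c = of_nat (k * count_list p k)"
    have X: "prod_list (map X p) = X k * prod_list (map X (remove1 k p))"
      using prod_list_map_remove1[OF k] .
    have "k * count_list p k \<noteq> 0"
      using z_partition_pos[OF p] unfolding z_partition_remove1[OF k] by auto
    then have "c \<noteq> 0"
      unfolding c_def by (simp only: of_nat_eq_0_iff not_False_eq_True)
    moreover have "of_nat (z_partition p) = c * of_nat (z_partition (remove1 k p))"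
      unfolding z_partition_remove1[OF k] c_def by (simp only: of_nat_mult)
    ultimately show ?thesis
      unfolding X c_def[symmetric] by simp
  qed
  have "of_nat d * cycle_index d X
      = (\<Sum>p\<in>partitions_of d. of_nat (\<Sum>k\<in>set p. k * count_list p k) * ?w p)"
    unfolding cycle_index_def sum_distrib_left
    by (intro sum.cong) (auto simp: partitions_of_def sum_list_eq_sum_count_nat)
  also have "\<dots> = (\<Sum>p\<in>partitions_of d. \<Sum>k\<in>set p. X k * ?w (remove1 k p))"
    by (intro sum.cong refl) (simp only: of_nat_sum sum_distrib_right step cong: sum.cong)
  also have "\<dots> = (\<Sum>k = 1..d. \<Sum>q\<in>partitions_of (d - k). X k * ?w q)"
    by (rule sum_over_parts)
  finally show ?thesis
    by (simp add: cycle_index_def sum_distrib_left)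
qed

lemma partitions_of_0: "partitions_of 0 = {[]}"
proof -
  have Nil: "p = []" if "sum_list p = 0" "\<forall>k\<in>set p. 1 \<le> k" for p :: "nat list"
    using that by (cases p) simp_all
  have "p \<in> partitions_of 0 \<longleftrightarrow> p = []" for p
    unfolding partitions_of_def mem_Collect_eq by (rule iffI, elim conjE, rule Nil) simp_all
  then show ?thesis by blast
qed

text \<open>Both sides satisfy the same Newton recursion, which determines them since \<open>d\<close> is invertible for
  \<open>d > 0\<close>.\<close>
lemma cycle_index_power_sum:
  fixes xs :: "'a::field_char_0 list"
  assumes "\<And>k. k \<ge> 1 \<Longrightarrow> X k = power_sum xs k"
  shows "cycle_index d X = complete_homogeneous xs d"
proof (induction d rule: less_induct)
  case (less d)
  show ?case
  proof (cases "d = 0")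
    case True
    then show ?thesis by (simp add: cycle_index_def partitions_of_0 z_partition_def)
  next
    case False
    have "of_nat d * cycle_index d X = of_nat d * complete_homogeneous xs d"
      unfolding newton_cycle_index newton_complete_homogeneous
      by (intro sum.cong) (auto simp: assms less.IH)
    with False show ?thesis by simp
  qed
qed

section \<open>Nonnegativity of complete homogeneous polynomials of even degree\<close>

lemma poly_exp_minus_tendsto_0:
  fixes p :: "real poly"
  shows "((\<lambda>t. poly p t * exp (- t)) \<longlongrightarrow> 0) at_top"
proof -
  have "((\<lambda>t. \<Sum>i\<le>degree p. coeff p i * (t ^ i / exp t)) \<longlongrightarrow> 0) at_top"
    by (intro tendsto_null_sum tendsto_mult_right_zero tendsto_power_div_exp_0)
  then show ?thesis
    by (simp add: poly_altdef exp_minus field_simps sum_distrib_left)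
qed

text \<open>The derivative of \<open>q(t) e\<^sup>-\<^sup>t\<close> is \<open>- (q - q') e\<^sup>-\<^sup>t\<close>, so this function is nonincreasing; it tends to
  \<open>0\<close> at infinity and is therefore nonnegative everywhere.\<close>
lemma poly_nonneg_if_minus_pderiv_nonneg:
  fixes q :: "real poly"
  assumes "\<And>t. poly q t - poly (pderiv q) t \<ge> 0"
  shows "poly q t \<ge> 0"
proof -
  define g where "g t = poly q t * exp (- t)" for t
  have deriv: "(g has_real_derivative - ((poly q s - poly (pderiv q) s) * exp (- s))) (at s)" for s
    unfolding g_def by (auto intro!: derivative_eq_intros simp: algebra_simps)
  have "g s \<le> g t" if "t \<le> s" for s
    using that
  proof (rule DERIV_nonpos_imp_nonincreasing)
    show "\<exists>y. (g has_real_derivative y) (at x) \<and> y \<le> 0" for x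
      using deriv[of x] assms[of x] by (intro exI conjI) auto
  qed
  then have "eventually (\<lambda>s. g s \<le> g t) at_top"
    by (auto simp: eventually_at_top_linorder)
  moreover have "(g \<longlongrightarrow> 0) at_top"
    unfolding g_def by (rule poly_exp_minus_tendsto_0)
  ultimately have "0 \<le> g t"
    by (intro tendsto_upperbound) auto
  then show ?thesis by (simp add: g_def zero_le_mult_iff)
qed

lemma poly_nonneg_if_minus_smult_pderiv_nonneg:
  fixes q :: "real poly"
  assumes nonneg: "\<And>t. poly q t - x * poly (pderiv q) t \<ge> 0"
  shows "poly q t \<ge> 0"
proof (cases "x = 0")
  case True
  then show ?thesis using nonneg[of t] by simp
next
  case False
  \<comment> \<open>Rescaling the variable by \<open>x\<close>, of either sign, reduces to \<open>x = 1\<close>.\<close>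
  define r where "r = q \<circ>\<^sub>p [:0, x:]"
  have "poly r u \<ge> 0" for u
  proof (rule poly_nonneg_if_minus_pderiv_nonneg)
    show "poly r s - poly (pderiv r) s \<ge> 0" for s
      using nonneg[of "x * s"]
      by (simp add: r_def poly_pcompose pderiv_pcompose pderiv_pCons mult.commute)
  qed
  from this[of "t / x"] False show ?thesis
    by (simp add: r_def poly_pcompose)
qed

text \<open>The polynomial \<open>\<Prod>\<^sub>x (1 - x D)\<^sup>-\<^sup>1 (t\<^sup>d / d!)\<close>, with \<open>D\<close> the derivative, written out; as a
  sequence in \<open>d\<close> these form an Appell sequence.\<close>
definition homogeneous_appell :: "real list \<Rightarrow> nat \<Rightarrow> real poly" where
  "homogeneous_appell xs d = (\<Sum>k\<le>d. monom (complete_homogeneous xs (d - k) / fact k) k)"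

lemma pderiv_homogeneous_appell:
  "pderiv (homogeneous_appell xs (Suc d)) = homogeneous_appell xs d"
proof -
  have "pderiv (homogeneous_appell xs (Suc d))
      = (\<Sum>k\<le>Suc d. pderiv (monom (complete_homogeneous xs (Suc d - k) / fact k) k))"
    by (simp only: homogeneous_appell_def pderiv_sum)
  also have "\<dots> = (\<Sum>k\<le>d. pderiv (monom (complete_homogeneous xs (d - k) / fact (Suc k)) (Suc k)))"
    by (subst sum.atMost_Suc_shift) (simp add: pderiv_monom)
  also have "\<dots> = homogeneous_appell xs d"
    unfolding homogeneous_appell_def
    by (intro sum.cong refl) (simp add: pderiv_monom fact_Suc field_simps del: of_nat_Suc)
  finally show ?thesis .
qed

lemma homogeneous_appell_Cons:
  "homogeneous_appell (x # xs) d - smult x (pderiv (homogeneous_appell (x # xs) d))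
     = homogeneous_appell xs d"
proof (cases d)
  case 0
  then show ?thesis by (simp add: homogeneous_appell_def pderiv_monom)
next
  case (Suc m)
  have *: "complete_homogeneous (x # xs) (Suc m - k)
      = complete_homogeneous xs (Suc m - k) + x * complete_homogeneous (x # xs) (m - k)"
    if "k \<le> m" for k
    using that by (simp add: Suc_diff_le)
  have "homogeneous_appell (x # xs) (Suc m)
      = (\<Sum>k\<le>m. monom (complete_homogeneous xs (Suc m - k) / fact k) k
              + smult x (monom (complete_homogeneous (x # xs) (m - k) / fact k) k))
        + monom (1 / fact (Suc m)) (Suc m)"
    unfolding homogeneous_appell_def sum.atMost_Suc
    by (intro arg_cong2[where f = "(+)"] sum.cong refl)
       (simp_all add: * add_divide_distrib add_monom smult_monom del: complete_homogeneous.simps)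
  also have "\<dots> = homogeneous_appell xs (Suc m) + smult x (homogeneous_appell (x # xs) m)"
    by (simp add: homogeneous_appell_def sum.distrib smult_sum2)
  finally show ?thesis
    unfolding Suc pderiv_homogeneous_appell by simp
qed

text \<open>Start from \<open>t\<^sup>d / d!\<close>, which is nonnegative for even \<open>d\<close>; each further variable \<open>x\<close> applies
  \<open>(1 - x D)\<^sup>-\<^sup>1\<close>, which preserves nonnegativity.\<close>
lemma homogeneous_appell_nonneg:
  assumes "even d"
  shows "poly (homogeneous_appell xs d) t \<ge> 0"
proof (induction xs arbitrary: t)
  case Nil
  have "homogeneous_appell [] d = (\<Sum>k\<le>d. if k = d then monom (1 / fact d) d else 0)"
    unfolding homogeneous_appell_def by (intro sum.cong) auto
  then show ?case using assms by (simp add: poly_monom zero_le_even_power)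
next
  case (Cons x xs)
  show ?case
  proof (rule poly_nonneg_if_minus_smult_pderiv_nonneg[where x = x])
    show "poly (homogeneous_appell (x # xs) d) s
        - x * poly (pderiv (homogeneous_appell (x # xs) d)) s \<ge> 0" for s
      using Cons.IH[of s] unfolding homogeneous_appell_Cons[of x xs d, symmetric] by simp
  qed
qed

text \<open>Hunter's theorem, obtained by evaluating the preceding polynomial at \<open>t = 0\<close>.\<close>
lemma complete_homogeneous_nonneg:
  fixes xs :: "real list"
  assumes "even d"
  shows "complete_homogeneous xs d \<ge> 0"
proof -
  have "poly (homogeneous_appell xs d) 0
      = (\<Sum>k\<le>d. if k = 0 then complete_homogeneous xs d else 0)"
    unfolding homogeneous_appell_def poly_sum by (intro sum.cong) (auto simp: poly_monom)
  then show ?thesis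
    using homogeneous_appell_nonneg[OF assms, of xs 0] by simp
qed

section \<open>Extraction of the middle coefficient\<close>

text \<open>On the \<open>(d+1)\<close>-st roots of unity the term with index \<open>j\<close> has exponent \<open>d - 2 j\<close>, which lies
  strictly between \<open>- (d + 1)\<close> and \<open>d + 1\<close>; hence only the term with exponent \<open>0\<close> survives the sum.\<close>

lemma sum_roots_of_unity_filter:
  fixes G :: "nat \<Rightarrow> complex"
  assumes "even d"
  defines "u \<equiv> (\<lambda>m. cis (2 * pi * real m / real (d + 1)))"
  shows "(\<Sum>m<d+1. \<Sum>j\<le>d. G j * u m ^ (d - j) * cnj (u m) ^ j) = of_nat (d + 1) * G (d div 2)"
proof -
  define N where "N = d + 1"
  define w where "w j = cis (2 * pi * (real d - 2 * real j) / real N)" for j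
  have u: "u m ^ (d - j) * cnj (u m) ^ j = w j ^ m" if "j \<le> d" for m j
  proof -
    have "u m ^ (d - j) * cnj (u m) ^ j
        = cis (real (d - j) * (2 * pi * real m / real N) + real j * (- (2 * pi * real m / real N)))"
      unfolding u_def N_def[symmetric] by (simp only: cis_cnj DeMoivre cis_mult)
    also have "real (d - j) * (2 * pi * real m / real N) + real j * (- (2 * pi * real m / real N))
        = real m * (2 * pi * (real d - 2 * real j) / real N)"
      using that by (simp add: of_nat_diff algebra_simps diff_divide_distrib add_divide_distrib)
    finally show ?thesis by (simp add: w_def DeMoivre)
  qed
  have sum_w: "(\<Sum>m<N. w j ^ m) = (if j = d div 2 then of_nat N else 0)" if "j \<le> d" for j
  proof (cases "j = d div 2")
    case True
    then have "w j = 1" using \<open>even d\<close> by (auto simp: w_def elim!: evenE)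
    then show ?thesis using True by simp
  next
    case False
    have "w j ^ N = cis (real N * (2 * pi * (real d - 2 * real j) / real N))"
      by (simp only: w_def DeMoivre)
    also have "real N * (2 * pi * (real d - 2 * real j) / real N)
        = 2 * pi * of_int (int d - 2 * int j)"
      by (simp add: N_def del: of_nat_Suc)
    finally have "w j ^ N = cis (2 * pi * of_int (int d - 2 * int j))" .
    then have "w j ^ N = 1"
      using cis_multiple_2pi[of "of_int (int d - 2 * int j)"] by simp
    moreover have "w j \<noteq> 1"
    proof
      assume "w j = 1"
      then have "cos (2 * pi * (real d - 2 * real j) / real N) = 1"
        by (metis Re_complex_of_real cis.sel(1) of_real_1 w_def)
      then obtain n :: int where "2 * pi * (real d - 2 * real j) / real N = of_int n * 2 * pi"
        by (auto simp: cos_one_2pi_int)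
      then have "(2 * pi) * (real d - 2 * real j) = (2 * pi) * (of_int n * real N)"
        by (simp add: divide_eq_eq N_def mult_ac del: of_nat_Suc)
      then have "real d - 2 * real j = of_int n * real N"
        by (simp only: mult_cancel_left) simp
      then have "of_int (int d - 2 * int j) = (of_int (n * int N) :: real)"
        by simp
      then have n: "int d - 2 * int j = n * int N"
        by (simp only: of_int_eq_iff)
      have "n = 0"
      proof (rule ccontr)
        assume "n \<noteq> 0"
        then have "1 * int N \<le> \<bar>n\<bar> * int N" by (intro mult_right_mono) auto
        also have "\<dots> = \<bar>int d - 2 * int j\<bar>" by (simp add: n abs_mult)
        also have "\<dots> \<le> int d" using that by simp
        finally show False by (simp add: N_def)
      qed
      with n False \<open>even d\<close> show False by auto
    qed
    ultimately show ?thesis using False by (simp add: geometric_sum)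
  qed
  have "(\<Sum>m<d+1. \<Sum>j\<le>d. G j * u m ^ (d - j) * cnj (u m) ^ j) = (\<Sum>m<N. \<Sum>j\<le>d. G j * w j ^ m)"
    unfolding N_def by (intro sum.cong refl) (simp add: u mult.assoc)
  also have "\<dots> = (\<Sum>j\<le>d. G j * (\<Sum>m<N. w j ^ m))"
    by (subst sum.swap) (simp add: sum_distrib_left)
  also have "\<dots> = (\<Sum>j\<le>d. if j = d div 2 then G j * of_nat N else 0)"
    by (intro sum.cong refl) (simp add: sum_w)
  also have "\<dots> = of_nat (d + 1) * G (d div 2)"
    by (simp add: N_def mult.commute)
  finally show ?thesis .
qed

section \<open>Uniqueness of expansions in a variable and its conjugate\<close>

text \<open>A power series is continuous at \<open>0\<close>, so its constant term vanishes; divide by the variable and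
  repeat.\<close>
lemma powser_zero_imp_coeffs_zero:
  fixes a :: "nat \<Rightarrow> 'a::{real_normed_field,banach}"
  assumes "0 < s" and sums: "\<And>x. x \<noteq> 0 \<Longrightarrow> norm x < s \<Longrightarrow> (\<lambda>n. a n * x ^ n) sums 0"
  shows "a m = 0"
proof (induction m rule: less_induct)
  case (less m)
  have "(\<lambda>n. a (n + m) * x ^ n) sums 0" if "x \<noteq> 0" "norm x < s" for x
  proof -
    have "(\<lambda>n. a (n + m) * x ^ (n + m)) sums 0"
      using sums_iff_shift[of "\<lambda>n. a n * x ^ n" m 0] sums[OF that] less.IH by simp
    then have "(\<lambda>n. a (n + m) * x ^ (n + m) / x ^ m) sums (0 / x ^ m)"
      by (rule sums_divide)
    then show ?thesis using that by (simp add: power_add)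
  qed
  then have "((\<lambda>x::'a. 0::'a) \<longlongrightarrow> a (0 + m)) (at 0)"
    using powser_limit_0_strong[of s "\<lambda>n. a (n + m)" "\<lambda>_. 0"] \<open>0 < s\<close> by simp
  then show ?case
    using tendsto_unique[OF _ tendsto_const, of "at (0::'a)" "0::'a" "a m"] by simp
qed

lemma has_sum_diagonals:
  fixes g :: "nat \<times> nat \<Rightarrow> complex"
  assumes "(g has_sum S) UNIV"
  shows "((\<lambda>d. \<Sum>j\<le>d. g (d - j, j)) has_sum S) UNIV"
proof -
  have "((\<lambda>(d, j). g (d - j, j)) has_sum S) (SIGMA d:UNIV. {..d})
      \<longleftrightarrow> (g has_sum S) UNIV"
    by (rule has_sum_reindex_bij_witness[of _ "\<lambda>(k, j). (k + j, j)" "\<lambda>(d, j). (d - j, j)"]) auto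
  with assms have "((\<lambda>(d, j). g (d - j, j)) has_sum S) (SIGMA d:UNIV. {..d})" by simp
  then show ?thesis
    by (rule has_sum_SigmaD[where B = atMost]) (auto intro: has_sum_finiteI)
qed

text \<open>On a line \<open>z = x u\<close> with \<open>x\<close> real and \<open>\<bar>u\<bar> = 1\<close>, grouping by total degree gives a power
  series in \<open>x\<close> that vanishes near \<open>0\<close>. Each of its coefficients \<open>\<Sum>\<^sub>i\<^sub>\<le>\<^sub>d c (d - i) i u\<^sup>d\<^sup>-\<^sup>i (cnj u)\<^sup>i\<close> vanishes, and
  multiplied by \<open>u\<^sup>d\<close> it is a polynomial in \<open>u\<close> with the infinitely many roots \<open>\<bar>u\<bar> = 1\<close>.\<close>
lemma zzbar_coeffs_zero:
  assumes "r > 0"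
    and zero: "\<And>z. norm z < r \<Longrightarrow> ((\<lambda>(j, k). c j k * z ^ j * cnj z ^ k) has_sum 0) UNIV"
  shows "c j k = 0"
proof -
  define P where "P u d = (\<Sum>j\<le>d. c (d - j) j * u ^ (d - j) * cnj u ^ j)" for u d
  have P0: "P u d = 0" if u: "norm u = 1" for u d
  proof -
    have P_sums: "(\<lambda>n. P u n * of_real x ^ n) sums 0" if "norm x < r" for x :: real
    proof -
      have "norm (of_real x * u) < r" using that u by (simp add: norm_mult)
      from has_sum_imp_sums[OF has_sum_diagonals[OF zero[OF this]]]
      have "(\<lambda>n. \<Sum>j\<le>n. c (n - j) j * (of_real x * u) ^ (n - j) * cnj (of_real x * u) ^ j) sums 0"
        by simp
      also have "(\<lambda>n. \<Sum>j\<le>n. c (n - j) j * (of_real x * u) ^ (n - j) * cnj (of_real x * u) ^ j)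
          = (\<lambda>n. P u n * of_real x ^ n)"
      proof
        fix n
        have "(of_real x * u) ^ (n - j) * cnj (of_real x * u) ^ j
            = u ^ (n - j) * cnj u ^ j * of_real x ^ n" if "j \<le> n" for j
        proof -
          have "(of_real x :: complex) ^ n = of_real x ^ (n - j) * of_real x ^ j"
            using that by (simp flip: power_add)
          then show ?thesis by (simp add: power_mult_distrib)
        qed
        then show "(\<Sum>j\<le>n. c (n - j) j * (of_real x * u) ^ (n - j) * cnj (of_real x * u) ^ j)
            = P u n * of_real x ^ n"
          unfolding P_def sum_distrib_right
          by (intro sum.cong refl) (simp add: mult.assoc)
      qed
      finally show ?thesis .
    qed
    have Re_Im_mult: "Re (w * of_real x ^ n) = Re w * x ^ n" "Im (w * of_real x ^ n) = Im w * x ^ n"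
      for w and x :: real and n
      by (simp_all flip: of_real_power)
    have "Re (P u d) = 0"
      using sums_Re[OF P_sums]
      by (intro powser_zero_imp_coeffs_zero[OF \<open>r > 0\<close>, of "\<lambda>n. Re (P u n)"]) (simp add: Re_Im_mult)
    moreover have "Im (P u d) = 0"
      using sums_Im[OF P_sums]
      by (intro powser_zero_imp_coeffs_zero[OF \<open>r > 0\<close>, of "\<lambda>n. Im (P u n)"]) (simp add: Re_Im_mult)
    ultimately show ?thesis by (simp add: complex_eq_iff)
  qed
  define d where "d = j + k"
  \<comment> \<open>For \<open>\<bar>u\<bar> = 1\<close> one has \<open>u\<^sup>d u\<^sup>j (cnj u)\<^sup>d\<^sup>-\<^sup>j = u\<^sup>2\<^sup>j\<close>, whence the exponents of \<open>q\<close>.\<close>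
  define q where "q = (\<Sum>j\<le>d. monom (c j (d - j)) (2 * j))"
  have "poly q u = 0" if u: "norm u = 1" for u
  proof -
    have uu: "u * cnj u = 1"
      using u by (simp add: complex_norm_square[symmetric])
    have "poly q u = (\<Sum>i\<le>d. c (d - i) i * u ^ (2 * (d - i)))"
      unfolding q_def poly_sum
      by (rule sum.reindex_bij_witness[of _ "\<lambda>i. d - i" "\<lambda>i. d - i"]) (auto simp: poly_monom)
    also have "\<dots> = u ^ d * P u d"
      unfolding P_def sum_distrib_left
    proof (intro sum.cong refl)
      fix i assume "i \<in> {..d}"
      then have "u ^ d = u ^ (d - i) * u ^ i" by (simp flip: power_add)
      then have "u ^ d * (c (d - i) i * u ^ (d - i) * cnj u ^ i)
          = c (d - i) i * (u ^ (d - i) * u ^ (d - i)) * (u * cnj u) ^ i"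
        by (simp add: power_mult_distrib mult_ac)
      then show "c (d - i) i * u ^ (2 * (d - i)) = u ^ d * (c (d - i) i * u ^ (d - i) * cnj u ^ i)"
        by (simp only: uu power_one mult_1_right mult_2 power_add)
    qed
    finally show ?thesis by (simp add: P0[OF u])
  qed
  then have "{u. norm u = 1} \<subseteq> {u. poly q u = 0}" by auto
  moreover have "infinite {u :: complex. norm u = 1}"
  proof -
    have "inj_on (\<lambda>x. Complex x (sqrt (1 - x\<^sup>2))) {0..1}"
      by (auto intro: inj_onI)
    moreover have "(\<lambda>x. Complex x (sqrt (1 - x\<^sup>2))) ` {0..1} \<subseteq> {u. norm u = 1}"
      by (auto simp: cmod_def power_le_one)
    moreover have "infinite {0..1::real}"
      by (rule infinite_Icc) simp
    ultimately show ?thesis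
      using finite_imageD finite_subset by blast
  qed
  ultimately have "q = 0"
    using poly_roots_finite[of q] finite_subset by blast
  then have "0 = coeff q (2 * j)" by simp
  also have "\<dots> = (\<Sum>i\<le>d. if i = j then c j k else 0)"
    unfolding q_def coeff_sum by (intro sum.cong) (auto simp: d_def)
  also have "\<dots> = c j k" by (simp add: d_def)
  finally show ?thesis by simp
qed

lemma has_zzbar_expansion_unique:
  assumes "has_zzbar_expansion_at_0 f c" "has_zzbar_expansion_at_0 f c'"
  shows "c = c'"
proof -
  from assms(1) obtain r where r: "r > 0"
    "\<And>z. norm z < r \<Longrightarrow> ((\<lambda>(j, k). c j k * z ^ j * cnj z ^ k) has_sum f z) UNIV"
    unfolding has_zzbar_expansion_at_0_def by blast
  from assms(2) obtain r' where r': "r' > 0"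
    "\<And>z. norm z < r' \<Longrightarrow> ((\<lambda>(j, k). c' j k * z ^ j * cnj z ^ k) has_sum f z) UNIV"
    unfolding has_zzbar_expansion_at_0_def by blast
  have "c j k - c' j k = 0" for j k
  proof (rule zzbar_coeffs_zero[of "min r r'"])
    show "min r r' > 0" using r r' by simp
  next
    fix z :: complex assume z: "norm z < min r r'"
    have "((\<lambda>x. (case x of (j, k) \<Rightarrow> c j k * z ^ j * cnj z ^ k)
        - (case x of (j, k) \<Rightarrow> c' j k * z ^ j * cnj z ^ k)) has_sum (f z - f z)) UNIV"
      using z has_sum_add[OF r(2) has_sum_uminusI[OF r'(2)], of z z]
      unfolding diff_conv_add_uminus by simp
    also have "(\<lambda>x. (case x of (j, k) \<Rightarrow> c j k * z ^ j * cnj z ^ k)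
        - (case x of (j, k) \<Rightarrow> c' j k * z ^ j * cnj z ^ k))
        = (\<lambda>(j, k). (c j k - c' j k) * z ^ j * cnj z ^ k)"
      by (auto simp: algebra_simps)
    finally show "((\<lambda>(j, k). (c j k - c' j k) * z ^ j * cnj z ^ k) has_sum 0) UNIV" by simp
  qed
  then show ?thesis by (intro ext) simp
qed

section \<open>Traces of powers, determinants and eigenvalues\<close>

lemma mat_adjoint_carrier [simp]: "A \<in> carrier_mat n n \<Longrightarrow> mat_adjoint A \<in> carrier_mat n n"
  by (auto simp: mat_adjoint_def)

lemma mat_adjoint_index:
  fixes A :: "complex mat"
  assumes "A \<in> carrier_mat n n" "i < n" "j < n"
  shows "mat_adjoint A $$ (i, j) = cnj (A $$ (j, i))"
  using assms by (simp add: mat_adjoint_def mat_of_rows_index)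

abbreviation mat_prod :: "nat \<Rightarrow> 'a::semiring_1 mat list \<Rightarrow> 'a mat" where
  "mat_prod n Bs \<equiv> foldr (*) Bs (1\<^sub>m n)"

lemma mat_prod_carrier:
  assumes "set Bs \<subseteq> carrier_mat n n"
  shows "mat_prod n Bs \<in> carrier_mat n n"
  using assms by (induction Bs) auto

lemma mult_mat_index:
  assumes "A \<in> carrier_mat n n" "B \<in> carrier_mat n n" "i < n" "j < n"
  shows "(A * B) $$ (i, j) = (\<Sum>l<n. A $$ (i, l) * B $$ (l, j))"
  using assms by (simp add: scalar_prod_def atLeast0LessThan)

lemma mat_trace_comm:
  fixes A :: "'a::comm_semiring_0 mat"
  assumes "A \<in> carrier_mat n n" "B \<in> carrier_mat n n"
  shows "mat_trace (A * B) = mat_trace (B * A)"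
proof -
  have "mat_trace (A * B) = (\<Sum>i<n. \<Sum>l<n. A $$ (i, l) * B $$ (l, i))"
    using assms by (auto simp: mat_trace_def mult_mat_index simp del: index_mult_mat(1) intro!: sum.cong)
  also have "\<dots> = (\<Sum>l<n. \<Sum>i<n. B $$ (l, i) * A $$ (i, l))"
    by (subst sum.swap) (simp add: mult.commute)
  also have "\<dots> = mat_trace (B * A)"
    using assms by (auto simp: mat_trace_def mult_mat_index simp del: index_mult_mat(1) intro!: sum.cong)
  finally show ?thesis .
qed

lemma mat_prod_replicate_similar:
  assumes H: "H \<in> carrier_mat n n" and wit: "similar_mat_wit H T P Q"
  shows "mat_prod n (replicate k H) = P * mat_prod n (replicate k T) * Q"
proof (induction k)
  case 0
  show ?case using similar_mat_witD2[OF H wit] by simp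
next
  case (Suc k)
  note W = similar_mat_witD2[OF H wit]
  define M where "M = mat_prod n (replicate k T)"
  have M: "M \<in> carrier_mat n n"
    unfolding M_def using W by (intro mat_prod_carrier) auto
  have "mat_prod n (replicate (Suc k) H) = (P * T * Q) * (P * M * Q)"
    using Suc.IH W(3) by (simp add: M_def)
  also have "\<dots> = P * T * ((Q * P) * (M * Q))"
    using W(4-7) M by (simp add: assoc_mult_mat[of _ n n _ n _ n])
  also have "(Q * P) * (M * Q) = M * Q"
    using W M by simp
  also have "P * T * (M * Q) = P * (T * M) * Q"
    using W(4-7) M by (simp add: assoc_mult_mat[of _ n n _ n _ n])
  finally show ?case by (simp add: M_def)
qed

text \<open>Triangularity is carried along because the diagonal of a product is the product of the diagonals
  only for triangular factors.\<close>
lemma upper_triangular_power: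
  fixes T :: "'a::comm_semiring_1 mat"
  assumes T: "T \<in> carrier_mat n n" and ut: "upper_triangular T"
  shows "upper_triangular (mat_prod n (replicate k T)) \<and>
     (\<forall>i<n. mat_prod n (replicate k T) $$ (i, i) = T $$ (i, i) ^ k)"
proof (induction k)
  case 0
  show ?case by (auto simp: upper_triangular_def)
next
  case (Suc k)
  define M where "M = mat_prod n (replicate k T)"
  have M: "M \<in> carrier_mat n n"
    unfolding M_def using T by (intro mat_prod_carrier) auto
  have T0: "T $$ (i, j) = 0" if "j < i" "i < n" for i j
    using ut T that by (auto simp: upper_triangular_def)
  have M0: "M $$ (i, j) = 0" if "j < i" "i < n" for i j
    using Suc.IH M that by (auto simp: upper_triangular_def M_def)
  have "(T * M) $$ (i, j) = 0" if "j < i" "i < n" for i j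
  proof -
    have "T $$ (i, l) * M $$ (l, j) = 0" if "l < n" for l
      using T0[of l i] M0[of j l] that \<open>j < i\<close> \<open>i < n\<close> by (cases "l < i") auto
    then show ?thesis using that by (simp add: mult_mat_index[OF T M] del: index_mult_mat(1))
  qed
  moreover have "(T * M) $$ (i, i) = T $$ (i, i) ^ Suc k" if "i < n" for i
  proof -
    have "(T * M) $$ (i, i) = (\<Sum>l<n. if l = i then T $$ (i, i) * M $$ (i, i) else 0)"
      unfolding mult_mat_index[OF T M that that]
    proof (intro sum.cong refl)
      fix l assume "l \<in> {..<n}"
      then show "T $$ (i, l) * M $$ (l, i) = (if l = i then T $$ (i, i) * M $$ (i, i) else 0)"
        using T0[of l i] M0[of i l] that by (cases l i rule: linorder_cases) auto
    qed
    also have "\<dots> = T $$ (i, i) ^ Suc k"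
      using Suc.IH that by (simp add: M_def)
    finally show ?thesis .
  qed
  ultimately show ?case using T M by (auto simp: upper_triangular_def M_def simp del: index_mult_mat(1))
qed

text \<open>By Schur decomposition the matrix is similar to a triangular one with diagonal \<open>es\<close>, and the
  trace is invariant under similarity.\<close>
lemma mat_trace_power:
  fixes H :: "complex mat"
  assumes H: "H \<in> carrier_mat n n" and cp: "char_poly H = (\<Prod>e\<leftarrow>es. [:- e, 1:])"
  shows "mat_trace (mat_prod n (replicate k H)) = power_sum es k"
proof -
  obtain T P Q where "schur_decomposition H es = (T, P, Q)"
    by (cases "schur_decomposition H es") auto
  from schur_decomposition[OF H cp this]
  have wit: "similar_mat_wit H T P Q" and ut: "upper_triangular T" and diag: "diag_mat T = es"
    by auto
  note W = similar_mat_witD2[OF H wit]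
  define M where "M = mat_prod n (replicate k T)"
  have M: "M \<in> carrier_mat n n"
    unfolding M_def using W by (intro mat_prod_carrier) auto
  have "mat_trace (mat_prod n (replicate k H)) = mat_trace (P * (M * Q))"
    using W(4-7) M unfolding mat_prod_replicate_similar[OF H wit] M_def[symmetric]
    by (simp add: assoc_mult_mat[of _ n n _ n _ n])
  also have "\<dots> = mat_trace (M * Q * P)"
    using W M by (intro mat_trace_comm[of _ n]) auto
  also have "M * Q * P = M"
    using W M by simp
  also have "mat_trace M = (\<Sum>i<n. T $$ (i, i) ^ k)"
    using M upper_triangular_power[OF W(5) ut, of k, folded M_def] by (simp add: mat_trace_def)
  also have "\<dots> = power_sum es k"
    using W(5) by (simp add: power_sum_def diag[symmetric] diag_mat_def comp_def
        interv_sum_list_conv_sum_set_nat atLeast0LessThan)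
  finally show ?thesis .
qed

lemma det_one_minus:
  fixes H :: "complex mat"
  assumes H: "H \<in> carrier_mat n n" and cp: "char_poly H = (\<Prod>e\<leftarrow>es. [:- e, 1:])"
  shows "det (1\<^sub>m n - H) = (\<Prod>e\<leftarrow>es. 1 - e)"
proof -
  have "1\<^sub>m n - H = - char_matrix H 1"
    using H by (intro eq_matI) (auto simp: char_matrix_def)
  then have "det (1\<^sub>m n - H) = poly (char_poly H) 1"
    by (simp add: char_poly_matrix[OF H])
  also have "\<dots> = (\<Prod>e\<leftarrow>es. 1 - e)"
    unfolding cp by (induction es) (auto simp: algebra_simps)
  finally show ?thesis .
qed

text \<open>For an eigenvector \<open>v\<close> the form \<open>q = v\<^sup>* H v\<close> is real and equals \<open>e\<close> times the squared norm of
  \<open>v\<close>.\<close>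
lemma hermitian_eigenvalue_real:
  fixes H :: "complex mat"
  assumes H: "H \<in> carrier_mat n n"
    and herm: "\<And>i j. i < n \<Longrightarrow> j < n \<Longrightarrow> H $$ (i, j) = cnj (H $$ (j, i))"
    and ev: "eigenvalue H e"
  shows "e \<in> \<real>"
proof -
  from ev H obtain v where v: "v \<in> carrier_vec n" "v \<noteq> 0\<^sub>v n" "H *\<^sub>v v = e \<cdot>\<^sub>v v"
    by (auto simp: eigenvalue_def eigenvector_def)
  define q where "q = (\<Sum>i<n. \<Sum>j<n. cnj (v $ i) * H $$ (i, j) * v $ j)"
  define s where "s = (\<Sum>i<n. (cmod (v $ i))\<^sup>2)"
  have "(\<Sum>j<n. H $$ (i, j) * v $ j) = e * v $ i" if "i < n" for i
  proof -
    have "(H *\<^sub>v v) $ i = (\<Sum>j<n. H $$ (i, j) * v $ j)"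
      using H v(1) that by (simp add: scalar_prod_def atLeast0LessThan)
    then show ?thesis using v that by simp
  qed
  then have "q = (\<Sum>i<n. cnj (v $ i) * (e * v $ i))"
    unfolding q_def by (intro sum.cong refl) (simp add: mult.assoc flip: sum_distrib_left)
  also have "\<dots> = e * of_real s"
    by (simp add: s_def sum_distrib_left complex_norm_square mult_ac del: of_real_power)
  finally have q: "q = e * of_real s" .
  have "cnj q = (\<Sum>i<n. \<Sum>j<n. v $ i * H $$ (j, i) * cnj (v $ j))"
    unfolding q_def cnj_sum by (intro sum.cong refl) (simp add: herm[of _ _, symmetric])
  also have "\<dots> = q"
    unfolding q_def by (subst sum.swap) (simp add: mult_ac)
  finally have "cnj e * of_real s = e * of_real s"
    by (simp add: q)
  moreover have "s \<noteq> 0"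
  proof -
    obtain i where "i < n" "v $ i \<noteq> 0"
      using v(1,2) by (metis carrier_vecD eq_vecI index_zero_vec)
    then have "0 < (cmod (v $ i))\<^sup>2" "(cmod (v $ i))\<^sup>2 \<le> s"
      unfolding s_def by (auto intro!: member_le_sum)
    then show ?thesis by linarith
  qed
  ultimately show ?thesis
    by (auto simp: Reals_cnj_iff)
qed

text \<open>The formal identity \<open>\<Prod>\<^sub>e (1 - e X) \<cdot> \<Sum>\<^sub>d h\<^sub>d X\<^sup>d = 1\<close> turns into a numerical one at \<open>X = 1\<close> by the
  Cauchy product. Absolute convergence is a hypothesis on the complete homogeneous polynomials
  themselves, so that no bound on the eigenvalues \<open>es\<close> has to be established; the product on the right
  is then automatically nonzero.\<close>
lemma sums_complete_homogeneous:
  fixes es :: "complex list"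
  assumes summable: "summable (\<lambda>d. norm (complete_homogeneous es d))"
  shows "complete_homogeneous es sums inverse (\<Prod>e\<leftarrow>es. 1 - e)"
proof -
  define q where "q = (\<Prod>e\<leftarrow>es. [:1, - e:])"
  have "fps_of_poly q = (\<Prod>e\<leftarrow>es. 1 - fps_const e * fps_X)"
    unfolding q_def
  proof (induction es)
    case (Cons e es)
    have "fps_of_poly [:1, - e:] = 1 - fps_const e * fps_X"
      by (simp add: fps_of_poly_pCons fps_of_poly_linear del: fps_const_neg flip: fps_const_neg)
    with Cons show ?case by (simp add: fps_of_poly_mult del: mult_pCons_left)
  qed simp
  then have fps: "fps_of_poly q * Abs_fps (complete_homogeneous es) = 1"
    using complete_homogeneous_fps[of es] by (simp add: mult.commute)
  have "(\<Sum>i\<le>k. coeff q i * complete_homogeneous es (k - i)) = (if k = 0 then 1 else 0)" for k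
    using arg_cong[OF fps, of "\<lambda>F. fps_nth F k"] by (simp add: fps_mult_nth atLeast0AtMost)
  moreover have "(\<lambda>k. coeff q k) sums (\<Sum>k\<le>degree q. coeff q k)"
    by (rule sums_finite) (auto simp: coeff_eq_0)
  then have q1: "(\<Sum>k. coeff q k) = poly q 1"
    by (simp add: poly_altdef sums_iff)
  have "summable (\<lambda>k. norm (coeff q k))"
    by (rule summable_finite[of "{..degree q}"]) (auto simp: coeff_eq_0)
  from Cauchy_product_sums[OF this summable]
  have "(\<lambda>k. \<Sum>i\<le>k. coeff q i * complete_homogeneous es (k - i))
    sums (poly q 1 * suminf (complete_homogeneous es))"
    by (simp add: q1)
  ultimately have "(\<lambda>k. if k = 0 then 1 else 0 :: complex)
      sums (poly q 1 * suminf (complete_homogeneous es))"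
    by simp
  with sums_single[of 0 "\<lambda>_. 1 :: complex"]
  have "poly q 1 * suminf (complete_homogeneous es) = 1"
    by (metis (no_types, lifting) sums_unique2 sums_cong)
  then have "suminf (complete_homogeneous es) = inverse (poly q 1)"
    by (metis inverse_unique)
  moreover have "poly q 1 = (\<Prod>e\<leftarrow>es. 1 - e)"
    unfolding q_def by (induction es) (auto simp: algebra_simps)
  ultimately show ?thesis
    using summable_sums[OF summable_norm_cancel[OF summable]] by simp
qed

section \<open>Expansion of traces of powers over words\<close>

text \<open>A word encodes a choice in each factor of a product: \<open>True\<close> stands for the second summand
  (later the adjoint) and \<open>False\<close> for the first.\<close>

definition words :: "nat \<Rightarrow> bool list set" where
  "words k = {w. length w = k}"

lemma finite_words [simp]: "finite (words k)"
  unfolding words_def using finite_lists_length_eq[of "UNIV :: bool set" k] by simp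

lemma sum_words_0 [simp]: "(\<Sum>w\<in>words 0. f w) = f []"
proof -
  have "words 0 = {[]}" by (auto simp: words_def)
  then show ?thesis by simp
qed

lemma sum_words_Suc:
  "(\<Sum>w\<in>words (Suc k). f w) = (\<Sum>w\<in>words k. f (True # w)) + (\<Sum>w\<in>words k. f (False # w))"
proof -
  have "words (Suc k) = (#) True ` words k \<union> (#) False ` words k"
  proof (rule Set.set_eqI)
    show "w \<in> words (Suc k) \<longleftrightarrow> w \<in> (#) True ` words k \<union> (#) False ` words k" for w
      by (cases w) (auto simp: words_def)
  qed
  moreover have "(#) True ` words k \<inter> (#) False ` words k = {}" by auto
  ultimately have "(\<Sum>w\<in>words (Suc k). f w)
      = (\<Sum>w\<in>(#) True ` words k. f w) + (\<Sum>w\<in>(#) False ` words k. f w)"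
    by (simp add: sum.union_disjoint)
  then show ?thesis by (simp add: sum.reindex)
qed

lemma sum_words_add:
  "(\<Sum>w\<in>words (k + m). f w) = (\<Sum>u\<in>words k. \<Sum>v\<in>words m. f (u @ v))"
  by (induction k arbitrary: f) (simp_all add: sum_words_Suc)

lemma sum_words_subsets:
  "(\<Sum>w\<in>words d. f w) = (\<Sum>S\<in>Pow {..<d}. f (map (\<lambda>j. j \<in> S) [0..<d]))"
proof (rule sum.reindex_bij_witness[of _ "\<lambda>S. map (\<lambda>j. j \<in> S) [0..<d]" "\<lambda>w. {j. j < d \<and> w ! j}"])
  fix w assume "w \<in> words d"
  then show "map (\<lambda>j. j \<in> {j. j < d \<and> w ! j}) [0..<d] = w"
    by (auto simp: words_def intro: nth_equalityI)
  then show "f (map (\<lambda>j. j \<in> {j. j < d \<and> w ! j}) [0..<d]) = f w" by simp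
qed (auto simp: words_def)

definition word_weight :: "'a::comm_monoid_mult \<Rightarrow> 'a \<Rightarrow> bool list \<Rightarrow> 'a" where
  "word_weight a b w = prod_list (map (\<lambda>x. if x then b else a) w)"

lemma word_weight_simps [simp]:
  "word_weight a b [] = 1"
  "word_weight a b (x # w) = (if x then b else a) * word_weight a b w"
  "word_weight a b (u @ v) = word_weight a b u * word_weight a b v"
  by (simp_all add: word_weight_def)

lemma word_weight_subset:
  assumes "S \<subseteq> {..<d}"
  shows "word_weight a b (map (\<lambda>j. j \<in> S) [0..<d]) = a ^ (d - card S) * b ^ card S"
proof -
  have "word_weight a b (map (\<lambda>j. j \<in> S) [0..<d]) = (\<Prod>j<d. if j \<in> S then b else a)"
    by (simp add: word_weight_def comp_def prod.list_conv_set_nth atLeast0LessThan)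
  also have "\<dots> = b ^ card ({..<d} \<inter> S) * a ^ card ({..<d} \<inter> - S)"
    by (simp add: prod.If_cases Collect_neg_eq)
  also have "{..<d} \<inter> S = S" using assms by auto
  also have "{..<d} \<inter> - S = {..<d} - S" by auto
  also have "card ({..<d} - S) = d - card S"
    using assms by (subst card_Diff_subset) (auto intro: finite_subset)
  finally show ?thesis by (simp add: mult.commute)
qed

lemma mat_prod_add_expand:
  fixes A B :: "'a::comm_semiring_1 mat"
  assumes A: "A \<in> carrier_mat n n" and B: "B \<in> carrier_mat n n" and "i < n" "j < n"
  shows "mat_prod n (replicate k (a \<cdot>\<^sub>m A + b \<cdot>\<^sub>m B)) $$ (i, j)
     = (\<Sum>w\<in>words k. word_weight a b w * mat_prod n (map (\<lambda>x. if x then B else A) w) $$ (i, j))"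
  using \<open>i < n\<close>
proof (induction k arbitrary: i)
  case 0
  then show ?case using \<open>j < n\<close> by simp
next
  case (Suc k)
  define H where "H = a \<cdot>\<^sub>m A + b \<cdot>\<^sub>m B"
  define X where "X = (\<lambda>x. if x then B else A)"
  define M where "M w = mat_prod n (map X w)" for w
  have X: "X x \<in> carrier_mat n n" for x using A B by (simp add: X_def)
  have M: "M w \<in> carrier_mat n n" for w
    unfolding M_def using X by (intro mat_prod_carrier) auto
  have H: "H \<in> carrier_mat n n" using A B by (simp add: H_def)
  have R: "mat_prod n (replicate k H) \<in> carrier_mat n n"
    using H by (intro mat_prod_carrier) auto
  have "mat_prod n (replicate (Suc k) H) $$ (i, j)
      = (\<Sum>l<n. H $$ (i, l) * mat_prod n (replicate k H) $$ (l, j))"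
    using mult_mat_index[OF H R Suc.prems \<open>j < n\<close>] by simp
  also have "\<dots> = (\<Sum>l<n. (b * B $$ (i, l) + a * A $$ (i, l)) *
      (\<Sum>w\<in>words k. word_weight a b w * M w $$ (l, j)))"
    using Suc A B by (intro sum.cong refl) (simp add: H_def M_def X_def add.commute)
  also have "\<dots> = (\<Sum>l<n. \<Sum>w\<in>words k. word_weight a b (True # w) * (B $$ (i, l) * M w $$ (l, j)))
      + (\<Sum>l<n. \<Sum>w\<in>words k. word_weight a b (False # w) * (A $$ (i, l) * M w $$ (l, j)))"
    by (simp add: algebra_simps sum.distrib sum_distrib_left)
  also have "\<dots> = (\<Sum>w\<in>words k. word_weight a b (True # w) * (\<Sum>l<n. B $$ (i, l) * M w $$ (l, j)))
      + (\<Sum>w\<in>words k. word_weight a b (False # w) * (\<Sum>l<n. A $$ (i, l) * M w $$ (l, j)))"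
    by (subst (1 2) sum.swap) (simp add: sum_distrib_left)
  also have "\<dots> = (\<Sum>w\<in>words (Suc k). word_weight a b w * M w $$ (i, j))"
    unfolding sum_words_Suc M_def list.map foldr.simps comp_def
    using mult_mat_index[OF A M Suc.prems \<open>j < n\<close>] mult_mat_index[OF B M Suc.prems \<open>j < n\<close>]
    by (simp add: M_def X_def del: index_mult_mat(1))
  finally show ?case by (simp add: H_def M_def X_def)
qed

lemma mat_trace_power_expand:
  fixes A B :: "'a::comm_semiring_1 mat"
  assumes A: "A \<in> carrier_mat n n" and B: "B \<in> carrier_mat n n"
  shows "mat_trace (mat_prod n (replicate k (a \<cdot>\<^sub>m A + b \<cdot>\<^sub>m B)))
     = (\<Sum>w\<in>words k. word_weight a b w * mat_trace (mat_prod n (map (\<lambda>x. if x then B else A) w)))"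
proof -
  have carr: "mat_prod n (map (\<lambda>x. if x then B else A) w) \<in> carrier_mat n n" for w
    using A B by (intro mat_prod_carrier) auto
  have carr': "mat_prod n (replicate k (a \<cdot>\<^sub>m A + b \<cdot>\<^sub>m B)) \<in> carrier_mat n n"
    using A B by (intro mat_prod_carrier) auto
  have "mat_trace (mat_prod n (replicate k (a \<cdot>\<^sub>m A + b \<cdot>\<^sub>m B)))
      = (\<Sum>i<n. \<Sum>w\<in>words k. word_weight a b w * mat_prod n (map (\<lambda>x. if x then B else A) w) $$ (i, i))"
    unfolding mat_trace_def carrier_matD(1)[OF carr']
    by (intro sum.cong refl mat_prod_add_expand A B) auto
  also have "\<dots> = (\<Sum>w\<in>words k. word_weight a b w * mat_trace (mat_prod n (map (\<lambda>x. if x then B else A) w)))"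
    unfolding mat_trace_def carrier_matD(1)[OF carr]
    by (subst sum.swap) (simp add: sum_distrib_left)
  finally show ?thesis .
qed

text \<open>Multiplying out: a tuple of words of the lengths listed in \<open>p\<close> is one word of length
  \<open>sum_list p\<close>, cut into blocks.\<close>
lemma prod_list_sum_words:
  fixes g :: "bool list \<Rightarrow> 'a::comm_semiring_1"
  shows "prod_list (map (\<lambda>k. \<Sum>w\<in>words k. word_weight a b w * g w) p)
     = (\<Sum>w\<in>words (sum_list p). word_weight a b w * prod_list (map g (split_blocks p w)))"
proof (induction p)
  case (Cons k p)
  have "(\<Sum>w\<in>words (k + sum_list p). word_weight a b w * prod_list (map g (split_blocks (k # p) w)))
      = (\<Sum>u\<in>words k. \<Sum>v\<in>words (sum_list p). (word_weight a b u * g u) *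
           (word_weight a b v * prod_list (map g (split_blocks p v))))"
    unfolding sum_words_add by (intro sum.cong refl) (simp add: words_def mult_ac)
  then show ?case by (simp add: Cons sum_product)
qed simp

lemma split_blocks_map: "split_blocks p (map f xs) = map (map f) (split_blocks p xs)"
  by (induction p arbitrary: xs) (simp_all add: take_map drop_map)

lemma prod_trace_power_expand:
  assumes A: "A \<in> carrier_mat n n"
  shows "prod_list (map (\<lambda>k. mat_trace (mat_prod n (replicate k (a \<cdot>\<^sub>m A + b \<cdot>\<^sub>m mat_adjoint A)))) p)
     = (\<Sum>S\<in>Pow {..<sum_list p}. a ^ (sum_list p - card S) * b ^ card S * replaced_trace_prod p S A)"
proof -
  define X where "X = (\<lambda>x. if x then mat_adjoint A else A)"
  define g where "g w = mat_trace (mat_prod n (map X w))" for w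
  have g: "mat_trace (mat_prod n (replicate k (a \<cdot>\<^sub>m A + b \<cdot>\<^sub>m mat_adjoint A)))
      = (\<Sum>w\<in>words k. word_weight a b w * g w)" for k
    using A mat_trace_power_expand[of A n "mat_adjoint A" k a b] by (simp add: g_def X_def)
  have r: "replaced_trace_prod p S A
      = prod_list (map g (split_blocks p (map (\<lambda>j. j \<in> S) [0..<sum_list p])))" for S
  proof -
    have "map (\<lambda>j. if j \<in> S then mat_adjoint A else A) [0..<sum_list p]
        = map X (map (\<lambda>j. j \<in> S) [0..<sum_list p])"
      by (simp add: X_def)
    then show ?thesis
      using A by (simp only: replaced_trace_prod_def Let_def split_blocks_map)
        (simp add: g_def comp_def)
  qed
  show ?thesis
    unfolding g prod_list_sum_words r
    by (subst sum_words_subsets) (intro sum.cong refl, simp add: word_weight_subset)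
qed

section \<open>Bounds for products of traces\<close>

lemma mat_prod_bound:
  fixes Bs :: "complex mat list"
  assumes "\<And>B. B \<in> set Bs \<Longrightarrow> B \<in> carrier_mat n n"
    and "\<And>B i j. B \<in> set Bs \<Longrightarrow> i < n \<Longrightarrow> j < n \<Longrightarrow> norm (B $$ (i, j)) \<le> m"
    and "m \<ge> 0" "i < n" "j < n"
  shows "norm (mat_prod n Bs $$ (i, j)) \<le> (real n * m) ^ length Bs"
  using assms(1,2,4)
proof (induction Bs arbitrary: i)
  case Nil
  then show ?case using \<open>j < n\<close> by simp
next
  case (Cons B Bs)
  have B: "B \<in> carrier_mat n n" using Cons.prems by simp
  have M: "mat_prod n Bs \<in> carrier_mat n n"
    using Cons.prems by (intro mat_prod_carrier) auto
  have "mat_prod n (B # Bs) $$ (i, j) = (\<Sum>l<n. B $$ (i, l) * mat_prod n Bs $$ (l, j))"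
    using mult_mat_index[OF B M Cons.prems(3) \<open>j < n\<close>] by simp
  also have "norm \<dots> \<le> (\<Sum>l<n. m * (real n * m) ^ length Bs)"
    using Cons \<open>m \<ge> 0\<close> by (intro sum_norm_le) (auto simp: norm_mult intro!: mult_mono)
  finally show ?case by simp
qed

text \<open>The crude factor \<open>n\<close> for each matrix, instead of a single one for the trace, makes the bound
  multiplicative over the blocks; it needs a nonempty product.\<close>
lemma mat_trace_prod_bound:
  fixes Bs :: "complex mat list"
  assumes "\<And>B. B \<in> set Bs \<Longrightarrow> B \<in> carrier_mat n n"
    and "\<And>B i j. B \<in> set Bs \<Longrightarrow> i < n \<Longrightarrow> j < n \<Longrightarrow> norm (B $$ (i, j)) \<le> m"
    and "m \<ge> 0" "Bs \<noteq> []"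
  shows "norm (mat_trace (mat_prod n Bs)) \<le> (real n * (real n * m)) ^ length Bs"
proof -
  have carr: "mat_prod n Bs \<in> carrier_mat n n"
    using assms(1) by (intro mat_prod_carrier) auto
  have "norm (mat_trace (mat_prod n Bs)) \<le> (\<Sum>i<n. (real n * m) ^ length Bs)"
    unfolding mat_trace_def carrier_matD(1)[OF carr]
    using assms by (intro sum_norm_le mat_prod_bound) auto
  also have "\<dots> = real n * (real n * m) ^ length Bs" by simp
  also have "\<dots> \<le> real n ^ length Bs * (real n * m) ^ length Bs"
  proof (cases "n = 0")
    case False
    then have "real n ^ 1 \<le> real n ^ length Bs"
      using \<open>Bs \<noteq> []\<close> by (intro power_increasing) (auto simp: Suc_le_eq)
    then show ?thesis using \<open>m \<ge> 0\<close> by (intro mult_right_mono) auto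
  qed auto
  finally show ?thesis by (simp add: power_mult_distrib)
qed

lemma split_blocks_trace_bound:
  fixes Bs :: "complex mat list"
  assumes "\<And>B. B \<in> set Bs \<Longrightarrow> B \<in> carrier_mat n n"
    and "\<And>B i j. B \<in> set Bs \<Longrightarrow> i < n \<Longrightarrow> j < n \<Longrightarrow> norm (B $$ (i, j)) \<le> m"
    and m: "m \<ge> 0" and "\<forall>k\<in>set p. k \<ge> 1" "length Bs = sum_list p"
  shows "norm (prod_list (map (\<lambda>Bs. mat_trace (mat_prod n Bs)) (split_blocks p Bs)))
     \<le> (real n * (real n * m)) ^ sum_list p"
  using assms(1,2,4,5)
proof (induction p arbitrary: Bs)
  case (Cons k p)
  define K where "K = real n * (real n * m)"
  have "norm (mat_trace (mat_prod n (take k Bs))) \<le> K ^ length (take k Bs)"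
    unfolding K_def using Cons.prems m
    by (intro mat_trace_prod_bound) (auto dest: in_set_takeD)
  moreover have "norm (prod_list (map (\<lambda>Bs. mat_trace (mat_prod n Bs)) (split_blocks p (drop k Bs))))
      \<le> K ^ sum_list p"
    unfolding K_def using Cons.prems by (intro Cons.IH) (auto dest: in_set_dropD)
  ultimately show ?case
    using Cons.prems m unfolding K_def[symmetric]
    by (auto simp: norm_mult power_add K_def intro!: mult_mono)
qed simp

lemma mat_entries_bounded:
  fixes A :: "complex mat"
  obtains m where "m \<ge> 0" "\<And>i j. i < n \<Longrightarrow> j < n \<Longrightarrow> norm (A $$ (i, j)) \<le> m"
proof
  show "0 \<le> (\<Sum>(i, j)\<in>{..<n} \<times> {..<n}. norm (A $$ (i, j)))"
    by (intro sum_nonneg) auto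
  show "norm (A $$ (i, j)) \<le> (\<Sum>(i, j)\<in>{..<n} \<times> {..<n}. norm (A $$ (i, j)))"
    if "i < n" "j < n" for i j
    using that member_le_sum[of "(i, j)" "{..<n} \<times> {..<n}" "\<lambda>(i, j). norm (A $$ (i, j))"] by auto
qed

lemma replaced_trace_prod_bound:
  assumes A: "A \<in> carrier_mat n n"
  obtains K where "K \<ge> 0"
    "\<And>d p S. p \<in> partitions_of d \<Longrightarrow> norm (replaced_trace_prod p S A) \<le> K ^ d"
proof -
  obtain m where m: "m \<ge> 0" "\<And>i j. i < n \<Longrightarrow> j < n \<Longrightarrow> norm (A $$ (i, j)) \<le> m"
    using mat_entries_bounded[of n A] by blast
  show ?thesis
  proof
    show "0 \<le> real n * (real n * m)" using m by simp
    fix d p S assume p: "p \<in> partitions_of d"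
    have "norm (replaced_trace_prod p S A) \<le> (real n * (real n * m)) ^ sum_list p"
      unfolding replaced_trace_prod_def Let_def carrier_matD(1)[OF A]
      using A m p
      by (intro split_blocks_trace_bound)
         (auto simp: mat_adjoint_index[OF A] partitions_of_def split: if_splits)
    then show "norm (replaced_trace_prod p S A) \<le> (real n * (real n * m)) ^ d"
      using p by (simp add: partitions_of_def)
  qed
qed

section \<open>The coefficients of the expansion\<close>

text \<open>The coefficient of \<open>a\<^sup>d\<^sup>-\<^sup>j b\<^sup>j\<close> in the degree \<open>d\<close> part of \<open>det (I - a A - b A\<^sup>*)\<^sup>-\<^sup>1\<close>; that this is
  so is shown below.\<close>

definition trace_coeff :: "complex mat \<Rightarrow> nat \<Rightarrow> nat \<Rightarrow> complex" where
  "trace_coeff A d j = (\<Sum>p\<in>partitions_of d.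
     (\<Sum>S | S \<subseteq> {..<d} \<and> card S = j. replaced_trace_prod p S A) / of_nat (z_partition p))"

lemma trace_coeff_middle:
  "of_nat (d choose (d div 2)) * (\<Sum>p\<in>partitions_of d. T_partition p A / of_nat (z_partition p))
     = trace_coeff A d (d div 2)"
  unfolding trace_coeff_def sum_distrib_left
proof (intro sum.cong refl)
  fix p assume "p \<in> partitions_of d"
  then have "sum_list p = d" by (simp add: partitions_of_def)
  then show "of_nat (d choose (d div 2)) * (T_partition p A / of_nat (z_partition p))
      = (\<Sum>S | S \<subseteq> {..<d} \<and> card S = d div 2. replaced_trace_prod p S A) / of_nat (z_partition p)"
    by (simp add: T_partition_def Let_def)
qed

lemma sum_by_card:
  "(\<Sum>S\<in>Pow {..<d}. f S) = (\<Sum>j\<le>d. \<Sum>S | S \<subseteq> {..<d} \<and> card S = j. f S)"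
proof -
  have "(\<Sum>j\<le>d. \<Sum>S\<in>{S \<in> Pow {..<d}. card S = j}. f S) = (\<Sum>S\<in>Pow {..<d}. f S)"
  proof (rule sum.group)
    show "card ` Pow {..<d} \<subseteq> {..d}"
      using card_mono[of "{..<d}"] by auto
  qed auto
  then show ?thesis by (simp add: Pow_def)
qed

text \<open>The complete homogeneous polynomial of the eigenvalues is the cycle index evaluated at the traces of
  powers of \<open>a A + b A\<^sup>*\<close>; expand these traces and collect the terms with \<open>j\<close> adjoints.\<close>
lemma trace_coeff_generating:
  assumes A: "A \<in> carrier_mat n n"
    and cp: "char_poly (a \<cdot>\<^sub>m A + b \<cdot>\<^sub>m mat_adjoint A) = (\<Prod>e\<leftarrow>es. [:- e, 1:])"
  shows "(\<Sum>j\<le>d. trace_coeff A d j * a ^ (d - j) * b ^ j) = complete_homogeneous es d"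
proof -
  define H where "H = a \<cdot>\<^sub>m A + b \<cdot>\<^sub>m mat_adjoint A"
  have H: "H \<in> carrier_mat n n" using A by (simp add: H_def)
  define r where "r p j = (\<Sum>S | S \<subseteq> {..<d} \<and> card S = j. replaced_trace_prod p S A)" for p j
  have "complete_homogeneous es d = cycle_index d (\<lambda>k. mat_trace (mat_prod n (replicate k H)))"
    using mat_trace_power[OF H cp[folded H_def]] by (intro cycle_index_power_sum[symmetric])
  also have "\<dots> = (\<Sum>p\<in>partitions_of d. \<Sum>j\<le>d. r p j / of_nat (z_partition p) * (a ^ (d - j) * b ^ j))"
    unfolding cycle_index_def
  proof (intro sum.cong refl)
    fix p assume "p \<in> partitions_of d"
    then have d: "sum_list p = d" by (simp add: partitions_of_def)
    have "prod_list (map (\<lambda>k. mat_trace (mat_prod n (replicate k H))) p)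
        = (\<Sum>j\<le>d. \<Sum>S | S \<subseteq> {..<d} \<and> card S = j. a ^ (d - card S) * b ^ card S * replaced_trace_prod p S A)"
      unfolding H_def prod_trace_power_expand[OF A] d sum_by_card ..
    also have "\<dots> = (\<Sum>j\<le>d. r p j * (a ^ (d - j) * b ^ j))"
      unfolding r_def sum_distrib_right by (intro sum.cong) auto
    finally show "prod_list (map (\<lambda>k. mat_trace (mat_prod n (replicate k H))) p) / of_nat (z_partition p)
        = (\<Sum>j\<le>d. r p j / of_nat (z_partition p) * (a ^ (d - j) * b ^ j))"
      by (simp add: sum_divide_distrib)
  qed
  also have "\<dots> = (\<Sum>j\<le>d. trace_coeff A d j * (a ^ (d - j) * b ^ j))"
    unfolding trace_coeff_def r_def by (subst sum.swap) (simp add: sum_distrib_right)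
  finally show ?thesis by (simp add: mult.assoc)
qed

text \<open>The frequencies of the cycle types add up to \<open>1\<close>, obtained here from the complete homogeneous
  polynomials of the single variable \<open>1\<close>.\<close>
lemma sum_inverse_z_partition:
  "(\<Sum>p\<in>partitions_of d. 1 / real (z_partition p)) = 1"
proof -
  have "complete_homogeneous [1 :: real] d = 1"
    by (induction d) auto
  moreover have "cycle_index d (\<lambda>_. 1) = complete_homogeneous [1 :: real] d"
    by (rule cycle_index_power_sum) (simp add: power_sum_def)
  moreover have "prod_list (map (\<lambda>_. 1 :: real) p) = 1" for p :: "nat list"
    by (induction p) auto
  ultimately show ?thesis by (simp add: cycle_index_def)
qed

text \<open>There are \<open>2\<^sup>d\<close> subsets of positions and the weights \<open>1 / z_partition p\<close> add up to \<open>1\<close>, so a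
  bound \<open>K\<^sup>d\<close> for each product of traces gives \<open>(2 K)\<^sup>d\<close>.\<close>
lemma trace_coeff_bound:
  assumes A: "A \<in> carrier_mat n n"
  obtains K where "K \<ge> 0" "\<And>d. (\<Sum>j\<le>d. norm (trace_coeff A d j)) \<le> K ^ d"
proof -
  obtain K where K: "K \<ge> 0"
    "\<And>d p S. p \<in> partitions_of d \<Longrightarrow> norm (replaced_trace_prod p S A) \<le> K ^ d"
    using replaced_trace_prod_bound[OF A] by blast
  show ?thesis
  proof
    show "2 * K \<ge> 0" using K by simp
    fix d
    have "(\<Sum>j\<le>d. norm (trace_coeff A d j))
        \<le> (\<Sum>j\<le>d. \<Sum>p\<in>partitions_of d. (\<Sum>S | S \<subseteq> {..<d} \<and> card S = j. K ^ d) / real (z_partition p))"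
    proof (intro sum_mono)
      fix j
      have "norm ((\<Sum>S | S \<subseteq> {..<d} \<and> card S = j. replaced_trace_prod p S A) / of_nat (z_partition p))
          \<le> (\<Sum>S | S \<subseteq> {..<d} \<and> card S = j. K ^ d) / real (z_partition p)"
        if "p \<in> partitions_of d" for p
        unfolding norm_divide norm_of_nat
        by (intro divide_right_mono sum_norm_le K that) simp
      then show "norm (trace_coeff A d j)
          \<le> (\<Sum>p\<in>partitions_of d. (\<Sum>S | S \<subseteq> {..<d} \<and> card S = j. K ^ d) / real (z_partition p))"
        unfolding trace_coeff_def by (intro sum_norm_le)
    qed
    also have "\<dots> = (\<Sum>p\<in>partitions_of d. (\<Sum>S\<in>Pow {..<d}. K ^ d) / real (z_partition p))"
      by (subst sum.swap) (simp only: sum_by_card sum_divide_distrib)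
    also have "\<dots> = (2 * K) ^ d * (\<Sum>p\<in>partitions_of d. 1 / real (z_partition p))"
      by (simp add: card_Pow sum_distrib_left power_mult_distrib)
    finally show "(\<Sum>j\<le>d. norm (trace_coeff A d j)) \<le> (2 * K) ^ d"
      by (simp add: sum_inverse_z_partition)
  qed
qed

text \<open>The geometric bound makes the double series absolutely summable near the origin, so it may be
  summed along the diagonals \<open>j + k = d\<close>. There it gives the complete homogeneous polynomials of the
  eigenvalues of \<open>z A + cnj z A\<^sup>*\<close>, whose sum is the inverse determinant.\<close>
lemma has_zzbar_expansion_inverse_det:
  assumes A: "A \<in> carrier_mat n n"
  shows "has_zzbar_expansion_at_0
     (\<lambda>z. inverse (det (1\<^sub>m n - z \<cdot>\<^sub>m A - cnj z \<cdot>\<^sub>m mat_adjoint A)))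
     (\<lambda>j k. trace_coeff A (j + k) k)"
proof -
  obtain K where K: "K \<ge> 0" "\<And>d. (\<Sum>j\<le>d. norm (trace_coeff A d j)) \<le> K ^ d"
    using trace_coeff_bound[OF A] by blast
  show ?thesis
    unfolding has_zzbar_expansion_at_0_def
  proof (intro exI conjI allI impI)
    \<comment> \<open>The radius \<open>1 / (K + 1)\<close> gives \<open>K \<bar>z\<bar> < 1\<close> also when \<open>K = 0\<close>.\<close>
    show "1 / (K + 1) > 0" using K by simp
    fix z :: complex assume "norm z < 1 / (K + 1)"
    then have "norm z * (K + 1) < 1"
      using K by (simp add: field_simps)
    then have Kz: "K * norm z < 1"
      using norm_ge_zero[of z] by (simp only: distrib_left mult.commute[of K])
    define H where "H = z \<cdot>\<^sub>m A + cnj z \<cdot>\<^sub>m mat_adjoint A"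
    have H: "H \<in> carrier_mat n n" using A by (simp add: H_def)
    obtain es where es: "char_poly H = (\<Prod>e\<leftarrow>es. [:- e, 1:])"
      using char_poly_factorized[OF H] by blast
    define g where "g d j = trace_coeff A d j * z ^ (d - j) * cnj z ^ j" for d j
    have g_sum: "(\<Sum>j\<le>d. g d j) = complete_homogeneous es d" for d
      unfolding g_def by (rule trace_coeff_generating[OF A es[unfolded H_def]])
    have g_bound: "(\<Sum>j\<le>d. norm (g d j)) \<le> (K * norm z) ^ d" for d
    proof -
      have "norm (g d j) = norm (trace_coeff A d j) * norm z ^ d" if "j \<le> d" for j
        using that by (simp add: g_def norm_mult norm_power mult.assoc flip: power_add)
      then have "(\<Sum>j\<le>d. norm (g d j)) = (\<Sum>j\<le>d. norm (trace_coeff A d j)) * norm z ^ d"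
        by (simp add: sum_distrib_right)
      also have "\<dots> \<le> K ^ d * norm z ^ d"
        by (intro mult_right_mono K) simp
      finally show ?thesis by (simp add: power_mult_distrib)
    qed
    have geometric: "summable (\<lambda>d. (K * norm z) ^ d)"
      using Kz K by (intro summable_geometric) simp
    have "norm (complete_homogeneous es d) \<le> (K * norm z) ^ d" for d
      unfolding g_sum[symmetric] using norm_sum g_bound by (rule order_trans)
    then have summable_h: "summable (\<lambda>d. norm (complete_homogeneous es d))"
      by (intro summable_comparison_test'[OF geometric]) simp
    have "det (1\<^sub>m n - z \<cdot>\<^sub>m A - cnj z \<cdot>\<^sub>m mat_adjoint A) = det (1\<^sub>m n - H)"
      using A carrier_matD[OF A] carrier_matD[OF mat_adjoint_carrier[OF A]]
      by (intro arg_cong[where f = det] eq_matI) (simp_all add: H_def)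
    also have "\<dots> = (\<Prod>e\<leftarrow>es. 1 - e)"
      by (rule det_one_minus[OF H es])
    finally have "complete_homogeneous es sums
        inverse (det (1\<^sub>m n - z \<cdot>\<^sub>m A - cnj z \<cdot>\<^sub>m mat_adjoint A))" (is "_ sums ?f")
      using sums_complete_homogeneous[OF summable_h] by simp
    with summable_h have "(complete_homogeneous es has_sum ?f) UNIV"
      by (rule norm_summable_imp_has_sum)
    moreover have "(\<lambda>(d, j). g d j) summable_on (SIGMA d:UNIV. {..d})"
    proof (rule abs_summable_summable, subst abs_summable_on_Sigma_iff, intro conjI ballI)
      show "(\<lambda>j. case (d, j) of (d, j) \<Rightarrow> g d j) abs_summable_on {..d}" for d
        by simp
      have "summable (\<lambda>d. norm (\<Sum>j\<le>d. norm (g d j)))"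
        using g_bound by (intro summable_comparison_test'[OF geometric]) (simp add: sum_nonneg)
      then have "(\<lambda>d. \<Sum>j\<le>d. norm (g d j)) abs_summable_on UNIV"
        by (subst summable_on_iff_abs_summable_on_real[symmetric])
           (auto intro: norm_summable_imp_summable_on)
      then show "(\<lambda>d. \<Sum>\<^sub>\<infinity>j\<in>{..d}. norm (case (d, j) of (d, j) \<Rightarrow> g d j)) abs_summable_on UNIV"
        by simp
    qed
    ultimately have "((\<lambda>(d, j). g d j) has_sum ?f) (SIGMA d:UNIV. {..d})"
      by (intro has_sum_SigmaI) (auto intro: has_sum_finiteI simp: g_sum)
    also have "((\<lambda>(d, j). g d j) has_sum ?f) (SIGMA d:UNIV. {..d})
        \<longleftrightarrow> ((\<lambda>(j, k). trace_coeff A (j + k) k * z ^ j * cnj z ^ k) has_sum ?f) UNIV"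
      by (rule has_sum_reindex_bij_witness[of _ "\<lambda>(j, k). (j + k, k)" "\<lambda>(d, j). (d - j, j)"])
         (auto simp: g_def)
    finally show "((\<lambda>(j, k). trace_coeff A (j + k) k * z ^ j * cnj z ^ k) has_sum ?f) UNIV" .
  qed
qed

text \<open>For \<open>b = cnj a\<close> the matrix \<open>a A + b A\<^sup>*\<close> is Hermitian, so its eigenvalues are real and Hunter's
  theorem applies.\<close>
lemma trace_coeff_sum_nonneg:
  fixes A :: "complex mat"
  assumes A: "A \<in> carrier_mat n n" and "even d"
  shows "\<exists>x\<ge>0. (\<Sum>j\<le>d. trace_coeff A d j * z ^ (d - j) * cnj z ^ j) = of_real x"
proof -
  define H where "H = z \<cdot>\<^sub>m A + cnj z \<cdot>\<^sub>m mat_adjoint A"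
  have H: "H \<in> carrier_mat n n" using A by (simp add: H_def)
  obtain es where es: "char_poly H = (\<Prod>e\<leftarrow>es. [:- e, 1:])"
    using char_poly_factorized[OF H] by blast
  have "e \<in> \<real>" if "e \<in> set es" for e
  proof (rule hermitian_eigenvalue_real[OF H])
    show "H $$ (i, j) = cnj (H $$ (j, i))" if "i < n" "j < n" for i j
      using that A by (simp add: H_def mat_adjoint_index[OF A] carrier_matD[OF mat_adjoint_carrier[OF A]])
    show "eigenvalue H e"
      unfolding eigenvalue_root_char_poly[OF H] es using that
      by (auto simp: poly_prod_list prod_list_zero_iff)
  qed
  then have "es = map of_real (map Re es)"
    by (simp add: map_idI)
  then have "complete_homogeneous es d = of_real (complete_homogeneous (map Re es) d)"
    by (metis complete_homogeneous_of_real)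
  then show ?thesis
    using trace_coeff_generating[OF A es[unfolded H_def]] complete_homogeneous_nonneg[OF \<open>even d\<close>]
    by auto
qed

text \<open>The middle coefficient is an average, over the \<open>(d+1)\<close>-st roots of unity, of the nonnegative
  values just found. This is what makes the \<open>d\<close>-th root in the norm genuine.\<close>
lemma trace_coeff_middle_nonneg:
  assumes A: "A \<in> carrier_mat n n" and "even d"
  obtains x where "x \<ge> 0" "trace_coeff A d (d div 2) = of_real x"
proof -
  define u where "u m = cis (2 * pi * real m / real (d + 1))" for m :: nat
  obtain y where y: "\<And>z. y z \<ge> 0"
    "\<And>z. (\<Sum>j\<le>d. trace_coeff A d j * z ^ (d - j) * cnj z ^ j) = of_real (y z)"
    using trace_coeff_sum_nonneg[OF A \<open>even d\<close>] by metis
  have "of_nat (d + 1) * trace_coeff A d (d div 2) = of_real (\<Sum>m<d+1. y (u m))"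
    using sum_roots_of_unity_filter[OF \<open>even d\<close>, of "trace_coeff A d"]
    by (simp add: y(2) u_def del: sum.lessThan_Suc)
  then have "trace_coeff A d (d div 2) = of_real ((\<Sum>m<d+1. y (u m)) / real (d + 1))"
    by (simp add: field_simps del: sum.lessThan_Suc of_nat_Suc of_nat_add)
  moreover have "(\<Sum>m<d+1. y (u m)) / real (d + 1) \<ge> 0"
    by (intro divide_nonneg_nonneg sum_nonneg y) simp
  ultimately show ?thesis using that by blast
qed

theorem theorem6:
  fixes A :: "complex mat" and n d :: nat
  assumes "A \<in> carrier_mat n n"
    and "d \<ge> 2" and "even d"
  shows "let f = (\<lambda>z. inverse (det (1\<^sub>m n - z \<cdot>\<^sub>m A - cnj z \<cdot>\<^sub>m mat_adjoint A)))
         in (\<exists>!c. has_zzbar_expansion_at_0 f c) \<and>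
            (\<forall>c. has_zzbar_expansion_at_0 f c \<longrightarrow>
               of_real (real (d choose (d div 2)) * partition_norm d A ^ d) = c (d div 2) (d div 2))"
proof -
  define f where "f = (\<lambda>z. inverse (det (1\<^sub>m n - z \<cdot>\<^sub>m A - cnj z \<cdot>\<^sub>m mat_adjoint A)))"
  define s where "s = (\<Sum>p\<in>partitions_of d. T_partition p A / of_nat (z_partition p))"
  have expansion: "has_zzbar_expansion_at_0 f (\<lambda>j k. trace_coeff A (j + k) k)"
    unfolding f_def by (rule has_zzbar_expansion_inverse_det[OF assms(1)])
  then have unique: "c = (\<lambda>j k. trace_coeff A (j + k) k)" if "has_zzbar_expansion_at_0 f c" for c
    using that has_zzbar_expansion_unique by blast
  obtain x where x: "x \<ge> 0" "trace_coeff A d (d div 2) = of_real x"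
    using trace_coeff_middle_nonneg[OF assms(1,3)] by blast
  define N where "N = d choose (d div 2)"
  have "N > 0" by (simp add: N_def)
  have "of_nat N * s = of_real x"
    using trace_coeff_middle[of d A] x(2) by (simp add: s_def N_def)
  then have s: "s = of_real (x / real N)"
    using \<open>N > 0\<close> by (simp add: field_simps)
  have "partition_norm d A ^ d = x / real N"
    using \<open>d \<ge> 2\<close> \<open>x \<ge> 0\<close>
    by (simp add: partition_norm_def s_def[symmetric] s del: of_real_divide)
  then have "of_real (real N * partition_norm d A ^ d) = trace_coeff A (d div 2 + d div 2) (d div 2)"
    using \<open>N > 0\<close> \<open>even d\<close> x(2) by (simp add: mult_2[symmetric])
  with expansion unique show ?thesis
    unfolding Let_def f_def[symmetric] N_def by blast
qed

end
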